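(* Consider an autonomous system $\dot{\mathbf{x}}=\mathbf{h}(\mathbf{x})$ on $\mathbb{R}^n$ that is semi-contracting in a bounded metric $\mathbf{M}(\mathbf{x})$, and a scalar cost function $V:\mathbb{R}^n\to\mathbb{R}$ such that $\dot V(\mathbf{x})\le0$ for all $\mathbf{x}$. Assume that one system equilibrium $\mathbf{x}^\star$ is locally attractive (e.g., that the linearization at $\mathbf{x}^\star$ is strictly stable). Then this equilibrium is unique, it is a global minimum of $V$, and all trajectories converge to it asymptotically.
   Context: All functions are assumed sufficiently smooth that derivatives of the necessary order exist and are continuous. $\dot V(\mathbf{x})=\nabla V(\mathbf{x})^\top\mathbf{h}(\mathbf{x})$ is the derivative of $V$ along the system. A metric is a function $\mathbf{M}:\mathbb{R}^n\to\mathbb{R}^{n\times n}$ whose values are symmetric positive definite matrices; it is bounded if there are constants $\beta_0,\beta_1$ with $\mathbf{0}\prec\beta_0^2\mathbf{I}\preceq\mathbf{M}(\mathbf{x})\preceq\beta_1^2\mathbf{I}$ for all $\mathbf{x}$. The system is semi-contracting in $\mathbf{M}$ if for all $\mathbf{x}\in\mathbb{R}^n$, $\dot{\mathbf{M}}+\mathbf{A}^\top\mathbf{M}+\mathbf{M}\mathbf{A}\preceq\mathbf{0}$, where $\mathbf{A}=\frac{\partial\mathbf{h}}{\partial\mathbf{x}}$ and $\dot{\mathbf{M}}=\sum_i\frac{\partial\mathbf{M}}{\partial x_i}h_i(\mathbf{x})$. An equilibrium $\mathbf{x}^\star$ is locally attractive if there is $\epsilon>0$ such that every trajectory starting in the Euclidean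 ball of radius $\epsilon$ around $\mathbf{x}^\star$ converges to $\mathbf{x}^\star$. The linearization at an equilibrium is strictly stable if all eigenvalues of the Jacobian there have strictly negative real part. *)

theory Defs
  imports "HOL-Analysis.Analysis"
begin

definition continuously_differentiable ::
    "('a::real_normed_vector \<Rightarrow> 'b::real_normed_vector) \<Rightarrow> bool" where
  "continuously_differentiable f \<longleftrightarrow>
     (\<exists>f' :: 'a \<Rightarrow> 'a \<Rightarrow>\<^sub>L 'b.
        (\<forall>x. (f has_derivative blinfun_apply (f' x)) (at x)) \<and> continuous_on UNIV f')"

definition partial_deriv ::
    "(real^'n \<Rightarrow> 'b::real_normed_vector) \<Rightarrow> 'n \<Rightarrow> real^'n \<Rightarrow> 'b" where
  "partial_deriv f i x = frechet_derivative f (at x) (axis i 1)"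

definition gradient :: "(real^'n \<Rightarrow> real) \<Rightarrow> real^'n \<Rightarrow> real^'n" where
  "gradient V x = (\<chi> i. partial_deriv V i x)"

definition orbital_deriv ::
    "(real^'n \<Rightarrow> real^'n) \<Rightarrow> (real^'n \<Rightarrow> real) \<Rightarrow> real^'n \<Rightarrow> real" where
  "orbital_deriv h V x = gradient V x \<bullet> h x"

definition metric_deriv ::
    "(real^'n \<Rightarrow> real^'n) \<Rightarrow> (real^'n \<Rightarrow> real^'n^'n) \<Rightarrow> real^'n \<Rightarrow> real^'n^'n" where
  "metric_deriv h M x = (\<Sum>i\<in>UNIV. (h x $ i) *\<^sub>R partial_deriv M i x)"

definition pos_definite :: "real^'n^'n \<Rightarrow> bool" where
  "pos_definite P \<longleftrightarrow> transpose P = P \<and> (\<forall>v. v \<noteq> 0 \<longrightarrow> 0 < v \<bullet> (P *v v))"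

definition pos_semidefinite :: "real^'n^'n \<Rightarrow> bool" where
  "pos_semidefinite P \<longleftrightarrow> transpose P = P \<and> (\<forall>v. 0 \<le> v \<bullet> (P *v v))"

definition loewner_le :: "real^'n^'n \<Rightarrow> real^'n^'n \<Rightarrow> bool" (infix "\<preceq>\<^sub>L" 50) where
  "P \<preceq>\<^sub>L Q \<longleftrightarrow> pos_semidefinite (Q - P)"

definition loewner_less :: "real^'n^'n \<Rightarrow> real^'n^'n \<Rightarrow> bool" (infix "\<prec>\<^sub>L" 50) where
  "P \<prec>\<^sub>L Q \<longleftrightarrow> pos_definite (Q - P)"

definition matrix_metric :: "(real^'n \<Rightarrow> real^'n^'n) \<Rightarrow> bool" where
  "matrix_metric M \<longleftrightarrow> (\<forall>x. pos_definite (M x))"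

definition bounded_metric :: "(real^'n \<Rightarrow> real^'n^'n) \<Rightarrow> bool" where
  "bounded_metric M \<longleftrightarrow> matrix_metric M \<and>
     (\<exists>\<beta>\<^sub>0 \<beta>\<^sub>1 :: real. \<forall>x.
        0 \<prec>\<^sub>L \<beta>\<^sub>0\<^sup>2 *\<^sub>R (mat 1 :: real^'n^'n) \<and> \<beta>\<^sub>0\<^sup>2 *\<^sub>R mat 1 \<preceq>\<^sub>L M x \<and> M x \<preceq>\<^sub>L \<beta>\<^sub>1\<^sup>2 *\<^sub>R mat 1)"

definition semi_contracting ::
    "(real^'n \<Rightarrow> real^'n) \<Rightarrow> (real^'n \<Rightarrow> real^'n^'n) \<Rightarrow> bool" where
  "semi_contracting h M \<longleftrightarrow>
     (\<forall>x. let A = jacobian h (at x)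
          in metric_deriv h M x + transpose A ** M x + M x ** A \<preceq>\<^sub>L 0)"

text \<open>A trajectory is a forward solution defined for all times \<open>t \<ge> 0\<close>; the values of the
  function at negative times are irrelevant.\<close>

definition trajectory :: "(real^'n \<Rightarrow> real^'n) \<Rightarrow> (real \<Rightarrow> real^'n) \<Rightarrow> bool" where
  "trajectory h x \<longleftrightarrow> (\<forall>t\<ge>0. (x has_vector_derivative h (x t)) (at t within {0..}))"

definition equilibrium :: "(real^'n \<Rightarrow> real^'n) \<Rightarrow> real^'n \<Rightarrow> bool" where
  "equilibrium h xs \<longleftrightarrow> h xs = 0"

definition locally_attractive :: "(real^'n \<Rightarrow> real^'n) \<Rightarrow> real^'n \<Rightarrow> bool" where
  "locally_attractive h xs \<longleftrightarrow>
     (\<exists>\<epsilon>>0. \<forall>x. trajectory h x \<and> x 0 \<in> ball xs \<epsilon> \<longrightarrow> (x \<longlongrightarrow> xs) at_top)"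

text \<open>Eigenvalues of a real matrix are taken over the complex numbers.\<close>

definition complex_eigenvalue :: "real^'n^'n \<Rightarrow> complex \<Rightarrow> bool" where
  "complex_eigenvalue A \<mu> \<longleftrightarrow>
     (\<exists>v :: complex^'n. v \<noteq> 0 \<and> map_matrix complex_of_real A *v v = \<mu> *s v)"

definition strictly_stable_linearization :: "(real^'n \<Rightarrow> real^'n) \<Rightarrow> real^'n \<Rightarrow> bool" where
  "strictly_stable_linearization h xs \<longleftrightarrow>
     (\<forall>\<mu>. complex_eigenvalue (jacobian h (at xs)) \<mu> \<longrightarrow> Re \<mu> < 0)"

end

theory Submission
  imports Defs
begin

text \<open>The quadratic form \<open>W = (y - x) \<bullet> M(x) (y - x)\<close> along two nearby trajectories \<open>x\<close>, \<open>y\<close>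
  satisfies \<open>W' \<le> \<eta> |y - x|\<^sup>2\<close>, with \<open>\<eta>\<close> as small as desired if the trajectories are close. Joining
  two arbitrary initial points by a fine chain shows that trajectories never separate by more than a
  constant factor; no geodesics or differentiable dependence on initial data are needed. Comparison
  with the equilibrium confines every trajectory to a ball, which gives global existence, and local
  attraction then spreads along segments.

  At a strictly stable equilibrium the Jacobian is dissipative for the inner product given by the
  metric and has no imaginary eigenvalues, from which a strict quadratic Lyapunov function is built
  algebraically.\<close>

section \<open>Trajectories of Lipschitz and smooth vector fields\<close>

text \<open>A matrix inequality controls infinitesimal separations only; for a finite separation e =
  y - x it leaves an error \<eta> |e|^2 that could accumulate over time. On a horizon
  \<open>T\<close> the choice \<eta> = \<open>b\<^sub>0 / T\<close> limits the total cost to one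
  factor exp(1). The admissible initial distance then shrinks with \<open>T\<close>, but a finer
  chain compensates, and the sum of its links does not depend on the mesh. Hence one constant
  \<open>gain\<close> serves all horizons.

  Existence cannot be presupposed, as \<open>h\<close> is only locally Lipschitz. The chain is
  therefore run for a bounded, globally Lipschitz field that agrees with \<open>h\<close> on a large
  ball, and the estimate itself shows that the ball is never left.

  At the equilibrium the metric form need not decrease strictly. The textbook strict form, an
  integral of matrix exponentials, would call for spectral decay bounds; a finite sum over powers of
  the Cayley transform needs only compactness.\<close>

lemma integral_has_vector_derivative_atLeast:
  fixes f :: "real \<Rightarrow> 'a::banach"
  assumes "continuous_on {0..} f" "t \<ge> 0"
  shows "((\<lambda>u. integral {0..u} f) has_vector_derivative f t) (at t within {0..})"
proof -
  have "((\<lambda>u. integral {0..u} f) has_vector_derivative f t) (at t within {0..t+1})"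
    by (rule integral_has_vector_derivative)
      (use assms in \<open>auto intro: continuous_on_subset\<close>)
  moreover have "at t within {0..} = at t within {0..t+1}"
    by (rule at_within_nhd[where S = "{..<t+1}"]) (use assms in auto)
  ultimately show ?thesis by simp
qed

text \<open>Picard iteration on the whole half-line at once: with x(t) = exp(2Kt) z(t) the integral
  operator halves sup distances between bounded continuous functions z, so no local solutions have
  to be glued. Boundedness of \<open>g\<close> keeps the operator among bounded functions.\<close>

lemma global_solution_of_lipschitz_bounded:
  fixes g :: "'a::euclidean_space \<Rightarrow> 'a"
  assumes lip: "L-lipschitz_on UNIV g" and bdd: "bounded (range g)"
  shows "\<exists>x. x 0 = p \<and> (\<forall>t\<ge>0. (x has_vector_derivative g (x t)) (at t within {0..}))"
proof -
  define K where "K = L + 1"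
  have "L \<ge> 0" using lip lipschitz_on_nonneg by blast
  hence K: "K > 0" by (simp add: K_def)
  have gl: "norm (g u - g v) \<le> K * norm (u - v)" for u v
  proof -
    have "norm (g u - g v) \<le> L * norm (u - v)"
      using lipschitz_onD[OF lip, of u v] by (simp add: dist_norm)
    thus ?thesis unfolding K_def by (smt (verit) norm_ge_zero mult_right_mono)
  qed
  have gc: "continuous_on UNIV g" using lip by (rule lipschitz_on_continuous_on)
  obtain B where B: "\<And>u. norm (g u) \<le> B" using bdd unfolding bounded_iff by auto
  have B0: "B \<ge> 0" using B[of 0] norm_ge_zero order_trans by blast
  define G where "G = (\<lambda>z::real \<Rightarrow> 'a. \<lambda>s. g (exp (2 * K * s) *\<^sub>R z s))"
  \<comment> \<open>\<open>bcontfun\<close> asks for functions on all of the real line;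
    \<open>max 0 t\<close> extends by a constant to the irrelevant negative times.\<close>
  define P where "P = (\<lambda>(z::real \<Rightarrow> 'a) t. exp (-2 * K * (max 0 t)) *\<^sub>R (p + integral {0..max 0 t} (G z)))"
  have Gc: "continuous_on S (G z)" if "continuous_on UNIV z" for z S
    unfolding G_def
    by (rule continuous_on_compose2[OF gc]) (auto intro!: continuous_intros continuous_on_subset[OF that])
  have der: "((\<lambda>u. integral {0..u} (G z)) has_vector_derivative G z t) (at t within {0..})"
    if "continuous_on UNIV z" "t \<ge> 0" for z t
    by (rule integral_has_vector_derivative_atLeast[OF Gc[OF that(1)] that(2)])
  have Gi: "G z integrable_on {0..t}" if "continuous_on UNIV z" for z t
    using Gc[OF that] by (rule integrable_continuous_interval)
  have Pc: "continuous_on UNIV (P z)" if "continuous_on UNIV z" for z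
  proof -
    have c: "continuous_on {0..} (\<lambda>u. integral {0..u} (G z))"
      unfolding continuous_on_eq_continuous_within
      using der[OF that] has_vector_derivative_continuous by fastforce
    show ?thesis unfolding P_def
      by (intro continuous_intros continuous_on_compose2[OF c]) auto
  qed
  have Pb: "norm (P z t) \<le> norm p + B / (2 * K)" if "continuous_on UNIV z" for z t
  proof -
    define s where "s = max 0 t"
    have s: "s \<ge> 0" by (simp add: s_def)
    have "norm (integral {0..s} (G z)) \<le> integral {0..s} (\<lambda>_. B)"
      by (rule integral_norm_bound_integral[OF Gi[OF that]]) (auto simp: G_def B)
    also have "\<dots> = B * s" using s by simp
    finally have "norm (p + integral {0..s} (G z)) \<le> norm p + B * s"
      by (smt (verit) norm_triangle_ineq)
    hence "norm (P z t) \<le> exp (-2 * K * s) * (norm p + B * s)"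
      by (simp add: P_def flip: s_def)
    also have "\<dots> = exp (-2 * K * s) * norm p + B * (exp (-2 * K * s) * s)" by (simp add: algebra_simps)
    also have "\<dots> \<le> norm p + B * (1 / (2 * K))"
    proof (intro add_mono mult_left_mono B0)
      show "exp (-2 * K * s) * norm p \<le> norm p"
        using K s by (intro mult_left_le_one_le) auto
      have "2 * K * s \<le> exp (2 * K * s)" using exp_ge_add_one_self[of "2 * K * s"] by linarith
      hence "exp (-2 * K * s) * (2 * K * s) \<le> exp (-2 * K * s) * exp (2 * K * s)" by (intro mult_left_mono) auto
      also have "\<dots> = 1" by (simp flip: exp_add)
      finally show "exp (-2 * K * s) * s \<le> 1 / (2 * K)" using K by (simp add: field_simps)
    qed
    finally show ?thesis by simp
  qed
  have Pbc: "P z \<in> bcontfun" if "continuous_on UNIV z" for z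
    using Pc[OF that] Pb[OF that] by (auto simp: bcontfun_def bounded_iff)
  define F where "F = (\<lambda>z::real \<Rightarrow>\<^sub>C 'a. Bcontfun (P (apply_bcontfun z)))"
  have Fa: "apply_bcontfun (F z) = P (apply_bcontfun z)" for z
    unfolding F_def by (rule Bcontfun_inverse[OF Pbc]) simp
  have contr: "dist (F z) (F w) \<le> 1/2 * dist z w" for z w
  proof (rule dist_bound)
    fix t :: real
    define s where "s = max 0 t"
    have s: "s \<ge> 0" by (simp add: s_def)
    let ?d = "dist z w"
    have cz: "continuous_on UNIV (apply_bcontfun z)" "continuous_on UNIV (apply_bcontfun w)" by simp_all
    \<comment> \<open>The weight exponent is twice the Lipschitz constant, so integration leaves
      \<open>?d/2\<close>: the origin of the contraction factor 1/2.\<close>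
    have fi: "((\<lambda>r. K * ?d * exp (2 * K * r)) has_integral (?d/2 * exp (2 * K * s) - ?d/2 * exp (2 * K*0))) {0..s}"
      by (rule fundamental_theorem_of_calculus[OF s])
        (auto intro!: derivative_eq_intros simp flip: has_real_derivative_iff_has_vector_derivative)
    have "norm (integral {0..s} (G z) - integral {0..s} (G w)) = norm (integral {0..s} (\<lambda>r. G z r - G w r))"
      using Gi[OF cz(1)] Gi[OF cz(2)] by (simp add: integral_diff)
    also have "\<dots> \<le> integral {0..s} (\<lambda>r. K * ?d * exp (2 * K * r))"
    proof (rule integral_norm_bound_integral)
      show "(\<lambda>r. G z r - G w r) integrable_on {0..s}"
        using Gi[OF cz(1)] Gi[OF cz(2)] by (rule integrable_diff)
      show "(\<lambda>r. K * ?d * exp (2 * K * r)) integrable_on {0..s}" using fi by blast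
      fix r
      have "norm (G z r - G w r) \<le> K * norm (exp (2 * K * r) *\<^sub>R z r - exp (2 * K * r) *\<^sub>R w r)"
        unfolding G_def by (rule gl)
      also have "\<dots> = K * (exp (2 * K * r) * dist (z r) (w r))"
        by (simp add: dist_norm flip: scaleR_diff_right)
      also have "\<dots> \<le> K * (exp (2 * K * r) * ?d)"
        using K by (intro mult_left_mono dist_bounded) auto
      finally show "norm (G z r - G w r) \<le> K * ?d * exp (2 * K * r)" by (simp add: mult_ac)
    qed
    also have "\<dots> = ?d/2 * exp (2 * K * s) - ?d/2" using integral_unique[OF fi] by (simp only: mult_zero_right exp_zero mult_1_right)
    finally have A: "norm (integral {0..s} (G z) - integral {0..s} (G w)) \<le> ?d/2 * exp (2 * K * s)"
      by (smt (verit) zero_le_dist divide_nonneg_nonneg)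
    have "dist (F z t) (F w t) = exp (-2 * K * s) * norm (integral {0..s} (G z) - integral {0..s} (G w))"
      by (simp add: Fa P_def dist_norm flip: s_def scaleR_diff_right)
    also have "\<dots> \<le> exp (-2 * K * s) * (?d/2 * exp (2 * K * s))" by (intro mult_left_mono A) auto
    also have "\<dots> = ?d/2 * (exp (-2 * K * s) * exp (2 * K * s))" by (simp add: mult_ac)
    also have "\<dots> = 1/2 * ?d" by (simp flip: exp_add)
    finally show "dist (F z t) (F w t) \<le> 1/2 * ?d" .
  qed
  have "\<exists>!z. F z = z"
    by (rule banach_fix_type[where c = "1/2"]) (use contr in auto)
  then obtain z where z: "F z = z" by auto
  define x where "x = (\<lambda>t. exp (2 * K * t) *\<^sub>R apply_bcontfun z t)"
  have Gx: "G z = (\<lambda>s. g (x s))" by (simp add: G_def x_def)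
  have xe: "x t = p + integral {0..t} (G z)" if "t \<ge> 0" for t
  proof -
    have "z t = P z t" using z Fa by metis
    thus ?thesis using that by (simp add: x_def P_def flip: exp_add)
  qed
  show ?thesis
  proof (intro exI[of _ x] conjI allI impI)
    show "x 0 = p" by (simp add: xe)
    fix t :: real assume t: "t \<ge> 0"
    have "((\<lambda>u. p + integral {0..u} (G z)) has_vector_derivative g (x t)) (at t within {0..})"
      using der[of z t] t by (auto intro!: derivative_eq_intros simp: Gx)
    thus "(x has_vector_derivative g (x t)) (at t within {0..})"
      by (rule has_vector_derivative_transform[rotated 2]) (use t xe in auto)
  qed
qed

lemma bounded_bilinear_matrix_vector_mult:
  "bounded_bilinear ((*v) :: real^'n^'m \<Rightarrow> real^'n \<Rightarrow> real^'m)"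
  unfolding bilinear_conv_bounded_bilinear[symmetric] bilinear_def
  by (auto intro!: linearI simp: algebra_simps scaleR_matrix_vector_assoc matrix_vector_mult_scaleR)

text \<open>Uniform continuity of \<open>D\<close> on the compact ball makes \<open>\<delta>\<close>
  independent of the base point; the mean value bound is applied on the convex set
  \<open>cball c R \<inter> ball x \<delta>\<close>, where \<open>D\<close> differs from
  \<open>D x\<close> by less than \<epsilon>.\<close>

lemma uniform_linearization_on_cball:
  fixes f :: "'a::euclidean_space \<Rightarrow> 'b::real_normed_vector"
  assumes der: "\<And>x. (f has_derivative blinfun_apply (D x)) (at x)"
    and cont: "continuous_on UNIV D" and "\<epsilon> > 0"
  shows "\<exists>\<delta>>0. \<forall>x\<in>cball c R. \<forall>y\<in>cball c R. norm (y - x) < \<delta> \<longrightarrow>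
           norm (f y - f x - D x (y - x)) \<le> \<epsilon> * norm (y - x)"
proof -
  have "uniformly_continuous_on (cball c R) D"
    by (rule compact_uniformly_continuous) (use cont continuous_on_subset in auto)
  then obtain \<delta> where \<delta>: "\<delta> > 0"
      "\<And>x y. x \<in> cball c R \<Longrightarrow> y \<in> cball c R \<Longrightarrow> dist y x < \<delta> \<Longrightarrow> dist (D y) (D x) < \<epsilon>"
    using \<open>\<epsilon> > 0\<close> unfolding uniformly_continuous_on_def by metis
  have "norm (f y - f x - D x (y - x)) \<le> \<epsilon> * norm (y - x)"
    if x: "x \<in> cball c R" and y: "y \<in> cball c R" and xy: "norm (y - x) < \<delta>" for x y
  proof -
    let ?S = "cball c R \<inter> ball x \<delta>"
    have xS: "x \<in> ?S" "y \<in> ?S" using x y xy \<delta>(1) by (auto simp: dist_norm norm_minus_commute)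
    have "norm (f y - f x - blinfun_apply (D x) (y - x)) \<le> norm (y - x) * \<epsilon>"
    proof (rule differentiable_bound_linearization[where S = ?S])
      fix t :: real assume t: "t \<in> {0..1}"
      have "x + t *\<^sub>R (y - x) = (1 - t) *\<^sub>R x + t *\<^sub>R y" by (simp add: algebra_simps)
      moreover have "convex ?S" by (intro convex_Int convex_cball convex_ball)
      ultimately show "x + t *\<^sub>R (y - x) \<in> ?S"
        using xS t unfolding convex_alt by simp
    next
      fix z assume "z \<in> ?S"
      thus "(f has_derivative blinfun_apply (D z)) (at z within ?S)"
        using der has_derivative_at_withinI by blast
      have "blinfun_apply (D z) - blinfun_apply (D x) = blinfun_apply (D z - D x)"
        by (auto simp: blinfun.diff_left)
      thus "onorm (blinfun_apply (D z) - blinfun_apply (D x)) \<le> \<epsilon>"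
        using \<delta>(2)[OF x, of z] \<open>z \<in> ?S\<close>
        by (simp add: norm_blinfun.rep_eq[symmetric] dist_norm norm_minus_commute less_imp_le)
    qed (rule xS)
    thus ?thesis by (simp add: mult.commute)
  qed
  thus ?thesis using \<delta>(1) by blast
qed

lemma lipschitz_on_cball:
  fixes f :: "'a::euclidean_space \<Rightarrow> 'b::real_normed_vector"
  assumes der: "\<And>x. (f has_derivative blinfun_apply (D x)) (at x)"
    and cont: "continuous_on UNIV D"
  shows "\<exists>L. L-lipschitz_on (cball c R) f"
proof -
  have "bounded (D ` cball c R)"
    by (intro compact_imp_bounded compact_continuous_image continuous_on_subset[OF cont]) auto
  then obtain B where B: "B > 0" "\<And>x. x \<in> cball c R \<Longrightarrow> norm (D x) \<le> B"
    unfolding bounded_pos by auto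
  have "norm (f x - f y) \<le> B * norm (x - y)" if "x \<in> cball c R" "y \<in> cball c R" for x y
    by (rule differentiable_bound[where S = "cball c R" and f' = "\<lambda>x. blinfun_apply (D x)"])
      (use that B in \<open>auto intro: has_derivative_at_withinI[OF der] simp flip: norm_blinfun.rep_eq\<close>)
  thus ?thesis using B(1) by (intro exI[of _ B] lipschitz_onI) (auto simp: dist_norm)
qed

lemma continuous_on_trajectory: "trajectory f x \<Longrightarrow> continuous_on {0..} x"
  unfolding trajectory_def continuous_on_eq_continuous_within
  using has_vector_derivative_continuous by fastforce

lemma trajectory_const: "f p = 0 \<Longrightarrow> trajectory f (\<lambda>_. p)"
  by (auto simp: trajectory_def)

lemma trajectory_shift:
  assumes "trajectory f x" "s \<ge> 0"
  shows "trajectory f (\<lambda>t. x (s + t))"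
  unfolding trajectory_def
proof (intro allI impI)
  fix t :: real assume t: "t \<ge> 0"
  have "((\<lambda>t. s + t) has_vector_derivative 1) (at t within {0..})"
    by (auto intro!: derivative_eq_intros)
  moreover have "(x has_vector_derivative f (x (s + t))) (at (s + t) within (\<lambda>t. s + t) ` {0..})"
    using assms t by (intro has_vector_derivative_within_subset[where S = "{0..}" and T = "(\<lambda>t. s + t) ` {0..}"]) (auto simp: trajectory_def)
  ultimately show "((\<lambda>t. x (s + t)) has_vector_derivative f (x (s + t))) (at t within {0..})"
    using vector_diff_chain_within[of "\<lambda>t. s + t" 1 t "{0..}" x] by (simp add: o_def)
qed

text \<open>Compactness gives a first time at which \<open>f\<close> reaches \<delta>, and
  \<open>step\<close> refutes it. This serves estimates that are valid only as long as two
  trajectories stay close. At time 0 the premise of \<open>step\<close> is vacuous, so it also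
  covers the start.\<close>

lemma continuous_bootstrap:
  fixes f :: "real \<Rightarrow> real"
  assumes cont: "continuous_on {0..T} f"
    and step: "\<And>t. t \<in> {0..T} \<Longrightarrow> \<forall>s\<in>{0..<t}. f s < \<delta> \<Longrightarrow> f t < \<delta>"
    and t: "t \<in> {0..T}"
  shows "f t < \<delta>"
proof (rule ccontr)
  assume "\<not> f t < \<delta>"
  define S where "S = {0..T} \<inter> f -` {\<delta>..}"
  have "closed S" unfolding S_def
    by (intro continuous_closed_preimage[OF cont]) auto
  moreover have "bounded S" unfolding S_def by (rule bounded_subset[OF bounded_closed_interval[of 0 T]]) auto
  ultimately have "compact S" by (simp add: compact_eq_bounded_closed)
  moreover have "S \<noteq> {}" using t \<open>\<not> f t < \<delta>\<close> by (auto simp: S_def)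
  ultimately obtain u where u: "u \<in> S" "\<forall>s\<in>S. u \<le> s" using compact_attains_inf by blast
  have "f u < \<delta>"
  proof (rule step)
    show "\<forall>s\<in>{0..<u}. f s < \<delta>"
    proof
      fix s assume s: "s \<in> {0..<u}"
      hence "s \<notin> S" using u(2) by fastforce
      thus "f s < \<delta>" using s u(1) by (auto simp: S_def)
    qed
  qed (use u in \<open>auto simp: S_def\<close>)
  thus False using u(1) by (auto simp: S_def)
qed

lemma trajectory_at_interior:
  assumes "trajectory f x" "t > 0"
  shows "(x has_vector_derivative f (x t)) (at t)"
proof -
  have "(x has_vector_derivative f (x t)) (at t within {0..})"
    using assms by (auto simp: trajectory_def)
  moreover have "at t within {0..} = at t"
    using assms by (intro at_within_interior) (auto simp: interior_Ici[of "-1::real"])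
  ultimately show ?thesis by simp
qed

section \<open>Semi-contraction\<close>

text \<open>The hypotheses in coordinate-free form: \<open>contraction\<close> is the matrix
  inequality tested on \<open>v\<close>, with the two Jacobian terms merged into the factor 2 by
  symmetry of \<open>M\<close>.\<close>

locale semi_contracting_system =
  fixes h :: "real^'n \<Rightarrow> real^'n"
    and M :: "real^'n \<Rightarrow> real^'n^'n"
    and Dh :: "real^'n \<Rightarrow> (real^'n) \<Rightarrow>\<^sub>L (real^'n)"
    and DM :: "real^'n \<Rightarrow> (real^'n) \<Rightarrow>\<^sub>L (real^'n^'n)"
    and b\<^sub>0 b\<^sub>1 :: real
  assumes h_deriv: "\<And>x. (h has_derivative blinfun_apply (Dh x)) (at x)"
    and Dh_cont: "continuous_on UNIV Dh"
    and M_deriv: "\<And>x. (M has_derivative blinfun_apply (DM x)) (at x)"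
    and M_sym: "\<And>x u v. u \<bullet> (M x *v v) = v \<bullet> (M x *v u)"
    and b0_pos: "0 < b\<^sub>0" and b1_pos: "0 < b\<^sub>1"
    and M_lower: "\<And>x v. b\<^sub>0 * (norm v)\<^sup>2 \<le> v \<bullet> (M x *v v)"
    and M_upper: "\<And>x v. v \<bullet> (M x *v v) \<le> b\<^sub>1 * (norm v)\<^sup>2"
    and contraction: "\<And>x v. v \<bullet> (DM x (h x) *v v) + 2 * (v \<bullet> (M x *v Dh x v)) \<le> 0"
begin

text \<open>The factor 3 leaves room for the growth \<open>exp 1\<close> permitted in \<open>close_trajectories\<close>.\<close>

definition gain :: real where "gain = sqrt (3 * b\<^sub>1 / b\<^sub>0)"

lemma gain_pos: "gain > 0"
  using b0_pos b1_pos by (simp add: gain_def)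

lemma h_continuous: "continuous_on S h"
  by (intro continuous_at_imp_continuous_on ballI has_derivative_continuous[OF h_deriv])

lemma M_continuous: "continuous_on S M"
  by (intro continuous_at_imp_continuous_on ballI has_derivative_continuous[OF M_deriv])

text \<open>The left side is the time derivative of the quadratic form of \<open>M x\<close> at
  \<open>y - x\<close> when both points move along \<open>h\<close>. With
  \<open>Dh x (y - x)\<close> in place of \<open>h y - h x\<close> it would be nonpositive, so only
  the linearization remainder is paid for.\<close>

lemma uniform_energy_estimate:
  assumes "\<eta> > 0"
  shows "\<exists>\<delta>>0. \<forall>x\<in>cball c R. \<forall>y\<in>cball c R. norm (y - x) < \<delta> \<longrightarrow>
           (y - x) \<bullet> (DM x (h x) *v (y - x)) + 2 * ((y - x) \<bullet> (M x *v (h y - h x)))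
             \<le> \<eta> * (norm (y - x))\<^sup>2"
proof -
  obtain K where K: "K > 0" "\<And>(A::real^'n^'n) (v::real^'n). norm (A *v v) \<le> norm A * norm v * K"
    using bounded_bilinear.pos_bounded[OF bounded_bilinear_matrix_vector_mult] by blast
  have "bounded (M ` cball c R)"
    by (intro compact_imp_bounded compact_continuous_image M_continuous) auto
  then obtain B where B: "B > 0" "\<And>x. x \<in> cball c R \<Longrightarrow> norm (M x) \<le> B"
    unfolding bounded_pos by auto
  \<comment> \<open>The 2 is the factor of the Jacobian term, \<open>B\<close> bounds
    \<open>M\<close> on the ball, and \<open>K\<close> is the norm constant of matrix-vector
    multiplication.\<close>
  define \<epsilon> where "\<epsilon> = \<eta> / (2 * B * K)"
  have \<epsilon>: "\<epsilon> > 0" "2 * B * K * \<epsilon> = \<eta>" using assms B(1) K(1) by (auto simp: \<epsilon>_def)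
  obtain \<delta> where \<delta>: "\<delta> > 0" and
    lin: "\<And>x y. x \<in> cball c R \<Longrightarrow> y \<in> cball c R \<Longrightarrow> norm (y - x) < \<delta> \<Longrightarrow>
           norm (h y - h x - Dh x (y - x)) \<le> \<epsilon> * norm (y - x)"
    using uniform_linearization_on_cball[OF h_deriv Dh_cont \<epsilon>(1)] by metis
  have "(y - x) \<bullet> (DM x (h x) *v (y - x)) + 2 * ((y - x) \<bullet> (M x *v (h y - h x))) \<le> \<eta> * (norm (y - x))\<^sup>2"
    if x: "x \<in> cball c R" and y: "y \<in> cball c R" and xy: "norm (y - x) < \<delta>" for x y
  proof -
    let ?e = "y - x"
    define \<rho> where "\<rho> = h y - h x - Dh x ?e"
    have "h y - h x = Dh x ?e + \<rho>" by (simp add: \<rho>_def)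
    hence "?e \<bullet> (M x *v (h y - h x)) = ?e \<bullet> (M x *v Dh x ?e) + ?e \<bullet> (M x *v \<rho>)"
      by (simp add: matrix_vector_right_distrib inner_add_right)
    moreover have "?e \<bullet> (M x *v \<rho>) \<le> norm ?e * (B * (\<epsilon> * norm ?e) * K)"
    proof -
      have "norm (M x *v \<rho>) \<le> norm (M x) * norm \<rho> * K" by (rule K(2))
      also have "\<dots> \<le> B * (\<epsilon> * norm ?e) * K"
        using B(2)[OF x] lin[OF x y xy] K(1) B(1)
        by (intro mult_right_mono mult_mono) (auto simp: \<rho>_def)
      finally have "norm ?e * norm (M x *v \<rho>) \<le> norm ?e * (B * (\<epsilon> * norm ?e) * K)"
        by (intro mult_left_mono) auto
      thus ?thesis using norm_cauchy_schwarz order_trans by blast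
    qed
    moreover have "2 * (norm ?e * (B * (\<epsilon> * norm ?e) * K)) = \<eta> * (norm ?e)\<^sup>2"
      unfolding \<epsilon>(2)[symmetric] by (simp add: power2_eq_square)
    ultimately show ?thesis using contraction[of ?e x] by linarith
  qed
  thus ?thesis using \<delta> by blast
qed

lemma close_trajectories:
  assumes rR: "r < R" and T: "T > 0"
  shows "\<exists>\<delta>>0. \<forall>f x y. (\<forall>z\<in>cball c R. f z = h z) \<longrightarrow> trajectory f x \<longrightarrow> trajectory f y \<longrightarrow>
           (\<forall>t\<in>{0..T}. x t \<in> cball c r) \<longrightarrow> gain * norm (y 0 - x 0) < \<delta> \<longrightarrow>
           (\<forall>t\<in>{0..T}. norm (y t - x t) \<le> gain * norm (y 0 - x 0))"
proof -
  \<comment> \<open>Then \<eta> |e|^2 is at most W / T by \<open>M_lower\<close>, and W grows by at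
    most the factor exp(1) on the horizon.\<close>
  define \<eta> where "\<eta> = b\<^sub>0 / T"
  have "\<eta> > 0" using T b0_pos by (simp add: \<eta>_def)
  then obtain \<delta>' where \<delta>': "\<delta>' > 0" and
    est: "\<And>x y. x \<in> cball c R \<Longrightarrow> y \<in> cball c R \<Longrightarrow> norm (y - x) < \<delta>' \<Longrightarrow>
           (y - x) \<bullet> (DM x (h x) *v (y - x)) + 2 * ((y - x) \<bullet> (M x *v (h y - h x)))
             \<le> \<eta> * (norm (y - x))\<^sup>2"
    using uniform_energy_estimate by metis
  \<comment> \<open>The margin \<open>R - r\<close> keeps \<open>y\<close> in the larger ball, where
    \<open>f\<close> agrees with \<open>h\<close>; only \<open>x\<close> is assumed to stay in the
    smaller one.\<close>
  define \<delta> where "\<delta> = min \<delta>' (R - r)"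
  have \<delta>: "\<delta> > 0" using \<delta>' rR by (simp add: \<delta>_def)
  have "norm (y t - x t) \<le> gain * norm (y 0 - x 0)"
    if f: "\<forall>z\<in>cball c R. f z = h z" and x: "trajectory f x" and y: "trajectory f y"
      and xr: "\<forall>t\<in>{0..T}. x t \<in> cball c r" and small: "gain * norm (y 0 - x 0) < \<delta>"
      and t: "t \<in> {0..T}" for f x y t
  proof -
    define e where "e = (\<lambda>t. y t - x t)"
    define W where "W = (\<lambda>t. e t \<bullet> (M (x t) *v e t))"
    have xc: "continuous_on {0..} x" and yc: "continuous_on {0..} y"
      using x y by (simp_all add: continuous_on_trajectory)
    have ec: "continuous_on {0..} e" unfolding e_def by (intro continuous_intros xc yc)
    have Mxc: "continuous_on {0..} (\<lambda>t. M (x t))"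
      by (rule continuous_on_compose2[OF M_continuous xc]) auto
    have Wc: "continuous_on {0..} W"
      unfolding W_def
      by (intro continuous_intros ec bounded_bilinear.continuous_on[OF bounded_bilinear_matrix_vector_mult] Mxc)
    have bound: "norm (e t) \<le> gain * norm (e 0)"
      if t: "t \<in> {0..T}" and near: "\<forall>s\<in>{0..<t}. norm (e s) < \<delta>" for t
    proof -
      have "exp (-(t / T)) * W t \<le> exp (-(0 / T)) * W 0"
      proof (rule DERIV_nonpos_imp_decreasing_open[where f = "\<lambda>t. exp (-(t / T)) * W t"])
        show "continuous_on {0..t} (\<lambda>t. exp (-(t / T)) * W t)"
          by (intro continuous_intros continuous_on_subset[OF Wc]) (use T in auto)
        fix s assume s: "0 < s" "s < t"
        have sx: "x s \<in> cball c r" using xr s t by auto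
        have es: "norm (e s) < \<delta>" using near s by auto
        have xR: "x s \<in> cball c R" using sx rR by auto
        have yR: "y s \<in> cball c R"
        proof -
          have "dist c (y s) \<le> dist c (x s) + norm (e s)"
            using dist_triangle[of c "y s" "x s"] by (simp add: e_def dist_norm norm_minus_commute)
          thus ?thesis using sx es by (auto simp: \<delta>_def)
        qed
        have xd: "(x has_vector_derivative h (x s)) (at s)"
          using trajectory_at_interior[OF x s(1)] f xR by auto
        have yd: "(y has_vector_derivative h (y s)) (at s)"
          using trajectory_at_interior[OF y s(1)] f yR by auto
        have ed: "(e has_vector_derivative (h (y s) - h (x s))) (at s)"
          unfolding e_def by (intro has_vector_derivative_diff xd yd)
        have Md: "((\<lambda>s. M (x s)) has_vector_derivative DM (x s) (h (x s))) (at s)"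
          using vector_derivative_diff_chain_within[OF xd, of M] M_deriv
          by (simp add: o_def has_derivative_at_withinI)
        have Med: "((\<lambda>s. M (x s) *v e s) has_vector_derivative
            (M (x s) *v (h (y s) - h (x s)) + DM (x s) (h (x s)) *v e s)) (at s)"
          by (rule bounded_bilinear.has_vector_derivative[OF bounded_bilinear_matrix_vector_mult Md ed])
        have Wd: "(W has_real_derivative
            (e s \<bullet> (M (x s) *v (h (y s) - h (x s)) + DM (x s) (h (x s)) *v e s)
              + (h (y s) - h (x s)) \<bullet> (M (x s) *v e s))) (at s)"
          unfolding W_def has_real_derivative_iff_has_vector_derivative
          by (rule bounded_bilinear.has_vector_derivative[OF bounded_bilinear_inner ed Med])
        define W' where "W' = e s \<bullet> (DM (x s) (h (x s)) *v e s) + 2 * (e s \<bullet> (M (x s) *v (h (y s) - h (x s))))"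
        have "e s \<bullet> (M (x s) *v (h (y s) - h (x s)) + DM (x s) (h (x s)) *v e s)
              + (h (y s) - h (x s)) \<bullet> (M (x s) *v e s) = W'"
          unfolding W'_def M_sym[of "h (y s) - h (x s)" "x s" "e s"] by (simp add: inner_add_right)
        hence Wd': "(W has_real_derivative W') (at s)" using Wd by simp
        have "W' \<le> \<eta> * (norm (e s))\<^sup>2"
          unfolding W'_def using est[OF xR yR] es by (simp add: e_def \<delta>_def)
        also have "\<dots> = (b\<^sub>0 * (norm (e s))\<^sup>2) / T" by (simp add: \<eta>_def)
        also have "\<dots> \<le> W s / T" using T M_lower unfolding W_def by (simp add: divide_right_mono)
        finally have "W' - W s / T \<le> 0" by simp
        moreover have "((\<lambda>t. exp (-(t / T)) * W t) has_real_derivative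
           (exp (-(s / T)) * (W' - W s / T))) (at s)"
          using T by (auto intro!: derivative_eq_intros Wd' simp: field_simps)
        ultimately show "\<exists>d. ((\<lambda>t. exp (-(t / T)) * W t) has_real_derivative d) (at s) \<and> d \<le> 0"
          by (meson exp_ge_zero mult_nonneg_nonpos)
      qed (use t in auto)
      hence "exp (-(t / T)) * W t \<le> W 0" by simp
      hence "exp (t / T) * (exp (-(t / T)) * W t) \<le> exp (t / T) * W 0" by (intro mult_left_mono) auto
      hence "W t \<le> exp (t / T) * W 0" by (simp add: mult.assoc[symmetric] flip: exp_add)
      also have "\<dots> \<le> 3 * W 0"
      proof (rule mult_right_mono)
        have "exp (t / T) \<le> exp 1" using t T by simp
        thus "exp (t / T) \<le> 3" using exp_le by linarith
        show "0 \<le> W 0" using M_lower[of "e 0" "x 0"] b0_pos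
          unfolding W_def by (meson order_trans zero_le_mult_iff zero_le_power2 less_imp_le)
      qed
      also have "\<dots> \<le> 3 * (b\<^sub>1 * (norm (e 0))\<^sup>2)" using M_upper by (simp add: W_def)
      finally have "b\<^sub>0 * (norm (e t))\<^sup>2 \<le> 3 * (b\<^sub>1 * (norm (e 0))\<^sup>2)"
        using M_lower[of "e t" "x t"] unfolding W_def by linarith
      hence "(norm (e t))\<^sup>2 \<le> (gain * norm (e 0))\<^sup>2"
        using b0_pos b1_pos by (simp add: gain_def power_mult_distrib field_simps)
      thus ?thesis by (rule power2_le_imp_le) (use gain_pos in auto)
    qed
    have "norm (e s) < \<delta>" if "s \<in> {0..T}" for s
    proof (rule continuous_bootstrap[where f = "\<lambda>s. norm (e s)", OF _ _ that])
      show "continuous_on {0..T} (\<lambda>s. norm (e s))"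
        by (intro continuous_intros continuous_on_subset[OF ec]) auto
      fix t assume "t \<in> {0..T}" "\<forall>s\<in>{0..<t}. norm (e s) < \<delta>"
      thus "norm (e t) < \<delta>" using bound[of t] small by (simp add: e_def)
    qed
    thus ?thesis using bound[OF t] t by (auto simp: e_def)
  qed
  thus ?thesis using \<delta> by blast
qed

text \<open>The bound for distant initial points follows by summing over a fine chain of intermediate
  initial points on the segment, each consecutive pair obeying \<open>close_trajectories\<close>.\<close>

lemma trajectory_near_bounded_trajectory:
  assumes x: "trajectory h x" and xr: "\<And>t. t \<ge> 0 \<Longrightarrow> x t \<in> cball c r"
  shows "\<exists>y. trajectory h y \<and> y 0 = q \<and> (\<forall>t\<ge>0. norm (y t - x t) \<le> gain * norm (q - x 0))"
proof -
  define d where "d = gain * norm (q - x 0)"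
  \<comment> \<open>Intermediate trajectories will stay within radius \<open>r + d\<close>; the
    extra 1 is the strict margin that \<open>close_trajectories\<close> requires.\<close>
  define R where "R = r + d + 1"
  \<comment> \<open>Projection onto the ball is nonexpansive, so \<open>g\<close> inherits the
    Lipschitz constant of \<open>h\<close> on the ball, now globally, and is bounded.\<close>
  define g where "g = (\<lambda>z. h (closest_point (cball c R) z))"
  have d: "d \<ge> 0" using gain_pos by (simp add: d_def)
  have r: "r \<ge> 0" using xr[of 0] by (auto intro: order_trans[OF zero_le_dist])
  have ne: "cball c R \<noteq> {}" using r d by (simp add: R_def)
  have cp: "closest_point (cball c R) z \<in> cball c R" for z
    using ne by (intro closest_point_in_set) auto
  obtain L where L: "L-lipschitz_on (cball c R) h"
    using lipschitz_on_cball[OF h_deriv Dh_cont] by blast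
  have "L-lipschitz_on UNIV g"
  proof (rule lipschitz_onI)
    fix u v :: "real^'n"
    have "dist (g u) (g v) \<le> L * dist (closest_point (cball c R) u) (closest_point (cball c R) v)"
      unfolding g_def by (rule lipschitz_onD[OF L cp cp])
    also have "\<dots> \<le> L * dist u v"
      using ne L by (intro mult_left_mono closest_point_lipschitz) (auto simp: lipschitz_on_def)
    finally show "dist (g u) (g v) \<le> L * dist u v" .
  qed (use L in \<open>auto simp: lipschitz_on_def\<close>)
  moreover have "bounded (range g)"
  proof (rule bounded_subset)
    show "bounded (h ` cball c R)"
      by (intro compact_imp_bounded compact_continuous_image h_continuous) auto
    show "range g \<subseteq> h ` cball c R" using cp by (auto simp: g_def)
  qed
  ultimately have "\<exists>z. z 0 = p \<and> trajectory g z" for p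
    unfolding trajectory_def using global_solution_of_lipschitz_bounded by blast
  then obtain \<phi> where \<phi>: "\<And>p. \<phi> p 0 = p" "\<And>p. trajectory g (\<phi> p)" by metis
  have gh: "\<forall>z\<in>cball c R. g z = h z" by (simp add: g_def closest_point_self)
  have xg: "trajectory g x"
    unfolding trajectory_def
  proof (intro allI impI)
    fix t :: real assume t: "t \<ge> 0"
    hence "g (x t) = h (x t)" using xr[of t] gh d by (auto simp: R_def)
    thus "(x has_vector_derivative g (x t)) (at t within {0..})"
      using x t by (simp add: trajectory_def)
  qed
  have bound: "norm (\<phi> q t - x t) \<le> d" if t: "t \<ge> 0" for t
  proof -
    \<comment> \<open>The horizon \<open>t + 1\<close> is positive also for \<open>t = 0\<close>.
      The mesh chosen below depends on it, the bound \<open>d\<close> does not.\<close>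
    have "r + d < R" "t + 1 > 0" using t by (auto simp: R_def)
    from close_trajectories[OF this, of c] obtain \<delta> where \<delta>: "\<delta> > 0" and
      close: "\<And>u v. trajectory g u \<Longrightarrow> trajectory g v \<Longrightarrow> (\<forall>s\<in>{0..t+1}. u s \<in> cball c (r + d)) \<Longrightarrow>
         gain * norm (v 0 - u 0) < \<delta> \<Longrightarrow> \<forall>s\<in>{0..t+1}. norm (v s - u s) \<le> gain * norm (v 0 - u 0)"
      using gh by (metis (no_types, lifting))
    obtain N :: nat where N: "N > 0" "d / N < \<delta>"
    proof -
      obtain N :: nat where "d / \<delta> < N" using reals_Archimedean2 by blast
      hence "d / Suc N < \<delta>" using \<delta> by (simp add: field_simps)
      thus thesis using that[of "Suc N"] by simp
    qed
    define p where "p = (\<lambda>i::nat. x 0 + (i / N) *\<^sub>R (q - x 0))"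
    \<comment> \<open>The chain starts with \<open>x\<close> itself, since no uniqueness result is
      at hand yet to identify \<open>\<phi> (x 0)\<close> with \<open>x\<close>.\<close>
    define z where "z = (\<lambda>i. if i = 0 then x else \<phi> (p i))"
    have z0: "z i 0 = p i" for i by (simp add: z_def \<phi> p_def)
    have zt: "trajectory g (z i)" for i by (simp add: z_def \<phi> xg)
    have step: "gain * norm (p (Suc i) - p i) = d / N" for i
    proof -
      have "p (Suc i) - p i = (1 / N) *\<^sub>R (q - x 0)"
        by (simp add: p_def add_divide_distrib scaleR_left.add)
      thus ?thesis by (simp add: d_def)
    qed
    have chain: "\<forall>s\<in>{0..t+1}. norm (z i s - x s) \<le> (i / N) * d" if "i \<le> N" for i
      using that
    proof (induction i)
      case 0 show ?case by (simp add: z_def)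
    next
      case (Suc i)
      have IH: "norm (z i s - x s) \<le> (i / N) * d" if "s \<in> {0..t+1}" for s
        using Suc that by auto
      \<comment> \<open>The accumulated distance is at most \<open>d\<close>, so the current link
        satisfies the confinement hypothesis needed for the next one.\<close>
      have "z i s \<in> cball c (r + d)" if s: "s \<in> {0..t+1}" for s
      proof -
        have "dist c (z i s) \<le> dist c (x s) + norm (z i s - x s)"
          using dist_triangle[of c "z i s" "x s"] by (simp add: dist_norm norm_minus_commute)
        moreover have "(i / N) * d \<le> 1 * d"
          using Suc.prems N d by (intro mult_right_mono) (auto simp: field_simps)
        ultimately show ?thesis using IH[OF s] xr[of s] s by auto
      qed
      hence "\<forall>s\<in>{0..t+1}. norm (z (Suc i) s - z i s) \<le> d / N"
        using close[OF zt[of i] zt[of "Suc i"]] step N(2) by (simp add: z0)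
      thus ?case
      proof (intro ballI)
        fix s assume s: "s \<in> {0..t+1}" and *: "\<forall>s\<in>{0..t+1}. norm (z (Suc i) s - z i s) \<le> d / N"
        have "norm (z (Suc i) s - x s) \<le> norm (z (Suc i) s - z i s) + norm (z i s - x s)"
          using norm_triangle_ineq[of "z (Suc i) s - z i s" "z i s - x s"] by simp
        also have "\<dots> \<le> d / N + (i / N) * d" using IH[OF s] * s by (intro add_mono) auto
        also have "\<dots> = (Suc i / N) * d" by (simp add: algebra_simps add_divide_distrib)
        finally show "norm (z (Suc i) s - x s) \<le> (Suc i / N) * d" .
      qed
    qed
    have "z N = \<phi> q" using N by (simp add: z_def p_def)
    thus ?thesis using chain[of N] N t by auto
  qed
  \<comment> \<open>The bound keeps \<open>\<phi> q\<close> in the ball on which truncation changes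
    nothing.\<close>
  have "trajectory h (\<phi> q)"
    unfolding trajectory_def
  proof (intro allI impI)
    fix t :: real assume t: "t \<ge> 0"
    have "dist c (\<phi> q t) \<le> dist c (x t) + norm (\<phi> q t - x t)"
      using dist_triangle[of c "\<phi> q t" "x t"] by (simp add: dist_norm norm_minus_commute)
    hence "\<phi> q t \<in> cball c R" using xr[OF t] bound[OF t] by (auto simp: R_def)
    thus "(\<phi> q has_vector_derivative h (\<phi> q t)) (at t within {0..})"
      using \<phi>(2)[of q] gh t by (auto simp: trajectory_def)
  qed
  thus ?thesis using \<phi>(1) bound unfolding d_def by blast
qed

text \<open>Equal initial points have gap 0, which is below the threshold for every horizon, and the
  estimate returns gap 0.\<close>

lemma trajectory_unique:
  assumes "trajectory h x" "\<And>t. t \<ge> 0 \<Longrightarrow> x t \<in> cball c r"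
    and "trajectory h y" "y 0 = x 0" and t: "t \<ge> 0"
  shows "y t = x t"
proof -
  have "r < r + 1" "t + 1 > 0" using t by auto
  from close_trajectories[OF this, of c] obtain \<delta> where "\<delta> > 0" and
    "\<And>u v. trajectory h u \<Longrightarrow> trajectory h v \<Longrightarrow> (\<forall>s\<in>{0..t+1}. u s \<in> cball c r) \<Longrightarrow>
       gain * norm (v 0 - u 0) < \<delta> \<Longrightarrow> \<forall>s\<in>{0..t+1}. norm (v s - u s) \<le> gain * norm (v 0 - u 0)"
    by (metis (no_types, lifting))
  from this(2)[of x y] this(1) show ?thesis using assms by auto
qed

end

section \<open>From local to global attraction\<close>

lemma tendsto_of_shifted:
  fixes x :: "real \<Rightarrow> 'b::topological_space"
  assumes "((\<lambda>t. x (s + t)) \<longlongrightarrow> l) at_top"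
  shows "(x \<longlongrightarrow> l) at_top"
proof -
  have "filterlim (\<lambda>t. -s + t) at_top at_top"
    by (rule filterlim_tendsto_add_at_top[OF tendsto_const filterlim_ident])
  from filterlim_compose[OF assms this] show ?thesis by simp
qed

locale semi_contracting_equilibrium = semi_contracting_system +
  fixes xs
  assumes equilibrium: "h xs = 0"
begin

lemma trajectory_exists: "\<exists>x. trajectory h x \<and> x 0 = p"
  using trajectory_near_bounded_trajectory[OF trajectory_const[of h xs, OF equilibrium], of xs 0 p] by auto

text \<open>Comparison with the constant trajectory at \<open>xs\<close> only produces some bounded
  trajectory from \<open>x 0\<close>; uniqueness, which needs just one of the two to be bounded,
  identifies it with \<open>x\<close>.\<close>

lemma trajectory_bounded:
  assumes x: "trajectory h x" and "t \<ge> 0"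
  shows "norm (x t - xs) \<le> gain * norm (x 0 - xs)"
proof -
  obtain y where y: "trajectory h y" "y 0 = x 0"
      "\<And>t. t \<ge> 0 \<Longrightarrow> norm (y t - xs) \<le> gain * norm (x 0 - xs)"
    using trajectory_near_bounded_trajectory[OF trajectory_const[of h xs, OF equilibrium], of xs 0 "x 0"] by auto
  have "x t = y t"
    by (rule trajectory_unique[OF y(1) _ x y(2)[symmetric] \<open>t \<ge> 0\<close>, where c = xs])
      (use y(3) in \<open>auto simp: dist_norm norm_minus_commute\<close>)
  thus ?thesis using y(3)[OF \<open>t \<ge> 0\<close>] by simp
qed

lemma trajectories_lipschitz:
  assumes x: "trajectory h x" and y: "trajectory h y" and "t \<ge> 0"
  shows "norm (y t - x t) \<le> gain * norm (y 0 - x 0)"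
proof -
  have bdd: "z t \<in> cball xs (gain * norm (z 0 - xs))" if "trajectory h z" "t \<ge> 0" for z t
    using trajectory_bounded[OF that] by (auto simp: dist_norm norm_minus_commute)
  obtain w where w: "trajectory h w" "w 0 = y 0"
      "\<And>t. t \<ge> 0 \<Longrightarrow> norm (w t - x t) \<le> gain * norm (y 0 - x 0)"
    using trajectory_near_bounded_trajectory[OF x bdd[OF x], of "y 0"] by auto
  have "y t = w t" by (rule trajectory_unique[OF w(1) bdd[OF w(1)] y w(2)[symmetric] \<open>t \<ge> 0\<close>])
  thus ?thesis using w(3)[OF \<open>t \<ge> 0\<close>] by simp
qed

text \<open>Attraction propagates along the segment from \<open>xs\<close> with a uniform step, because
  trajectories never separate by more than the factor \<open>gain\<close>.\<close>

lemma globally_attractive: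
  assumes "locally_attractive h xs" and x: "trajectory h x"
  shows "(x \<longlongrightarrow> xs) at_top"
proof -
  obtain \<epsilon> where \<epsilon>: "\<epsilon> > 0" and
    attr: "\<And>x. trajectory h x \<Longrightarrow> x 0 \<in> ball xs \<epsilon> \<Longrightarrow> (x \<longlongrightarrow> xs) at_top"
    using assms(1) unfolding locally_attractive_def by blast
  define d where "d = gain * norm (x 0 - xs)"
  obtain N :: nat where N: "N > 0" "d / N < \<epsilon> / 2"
  proof -
    obtain N :: nat where "d / (\<epsilon> / 2) < N" using reals_Archimedean2 by blast
    hence "d / Suc N < \<epsilon> / 2" using \<epsilon> by (simp add: field_simps)
    thus thesis using that[of "Suc N"] by simp
  qed
  define p where "p = (\<lambda>i::nat. xs + (i / N) *\<^sub>R (x 0 - xs))"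
  have step: "gain * norm (p (Suc i) - p i) = d / N" for i
  proof -
    have "p (Suc i) - p i = (1 / N) *\<^sub>R (x 0 - xs)"
      by (simp add: p_def add_divide_distrib scaleR_left.add)
    thus ?thesis by (simp add: d_def)
  qed
  have "\<forall>y. trajectory h y \<and> y 0 = p i \<longrightarrow> (y \<longlongrightarrow> xs) at_top" for i
  proof (induction i)
    case 0 show ?case using attr \<epsilon> by (auto simp: p_def)
  next
    case (Suc i)
    show ?case
    proof (intro allI impI, elim conjE)
      fix y assume y: "trajectory h y" "y 0 = p (Suc i)"
      obtain z where z: "trajectory h z" "z 0 = p i" using trajectory_exists by blast
      have "(z \<longlongrightarrow> xs) at_top" using Suc z by blast
      \<comment> \<open>Half of \<epsilon> goes to the approach of \<open>z\<close>, half to the gap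
        between \<open>y\<close> and \<open>z\<close>; at time \<open>s\<close> the trajectory
        \<open>y\<close> is then inside the attracting ball.\<close>
      hence "\<forall>\<^sub>F t in at_top. dist (z t) xs < \<epsilon> / 2" using \<epsilon> by (intro tendstoD) auto
      then obtain s where s: "dist (z s) xs < \<epsilon> / 2" "s \<ge> 0"
        unfolding eventually_at_top_linorder by (metis max.cobounded1 max.cobounded2)
      have "norm (y s - z s) \<le> d / N"
        using trajectories_lipschitz[OF z(1) y(1) s(2)] step[of i] by (simp add: y z)
      hence "norm (y s - z s) < \<epsilon> / 2" using N(2) by linarith
      hence "dist (y s) xs < \<epsilon>" using s dist_triangle[of "y s" xs "z s"] by (simp add: dist_norm)
      hence "((\<lambda>t. y (s + t)) \<longlongrightarrow> xs) at_top"
        using attr[OF trajectory_shift[OF y(1) s(2)]] by (simp add: dist_commute)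
      thus "(y \<longlongrightarrow> xs) at_top" by (rule tendsto_of_shifted)
    qed
  qed
  moreover have "x 0 = p N" using N by (simp add: p_def)
  ultimately show ?thesis using x by blast
qed

end

section \<open>Strict Lyapunov forms for dissipative linear maps\<close>

text \<open>This extracts first-order conditions from quadratic inequalities along a line: in both
  uses the t^2 terms cancel.\<close>

lemma affine_nonneg_imp_slope_zero:
  fixes c d :: real
  assumes "\<And>t. 0 \<le> c + t * d"
  shows "d = 0"
proof (rule ccontr)
  assume "d \<noteq> 0"
  thus False using assms[of "-(c + 1) / d"] by simp
qed

text \<open>Minimum on the compact unit sphere, then homogeneity of degree two. The map
  \<open>L\<close> is the identity for inner products and -A for the decay rate.\<close>

lemma pos_quadratic_lower_bound:
  fixes Y :: "'a::euclidean_space \<Rightarrow> 'a \<Rightarrow> real"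
  assumes Y: "bounded_bilinear Y" and L: "linear L"
    and pos: "\<And>w. w \<noteq> 0 \<Longrightarrow> 0 < Y w (L w)"
  shows "\<exists>c>0. \<forall>w. c * (norm w)\<^sup>2 \<le> Y w (L w)"
proof -
  interpret Y: bounded_bilinear Y by fact
  have "continuous_on (sphere 0 1) (\<lambda>w. Y w (L w))"
    using L by (intro Y.continuous_on continuous_intros linear_continuous_on) (simp add: linear_conv_bounded_linear)
  moreover have "compact (sphere (0::'a) 1)" "sphere (0::'a) 1 \<noteq> {}" by auto
  ultimately obtain a where a: "a \<in> sphere 0 1" "\<And>w. w \<in> sphere 0 1 \<Longrightarrow> Y a (L a) \<le> Y w (L w)"
    using continuous_attains_inf by metis
  have "Y a (L a) * (norm w)\<^sup>2 \<le> Y w (L w)" for w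
  proof (cases "w = 0")
    case True thus ?thesis using L by (simp add: linear_0 Y.zero_left)
  next
    case False
    let ?u = "w /\<^sub>R norm w"
    have "w = norm w *\<^sub>R ?u" using False by simp
    hence "Y w (L w) = (norm w)\<^sup>2 * Y ?u (L ?u)"
      using L by (metis Y.scaleR_left Y.scaleR_right linear_scale mult.assoc power2_eq_square real_scaleR_def)
    moreover have "Y a (L a) \<le> Y ?u (L ?u)" using False by (intro a(2)) auto
    ultimately show ?thesis by (metis mult.commute mult_left_mono zero_le_power2)
  qed
  moreover have "a \<noteq> 0" using a(1) by auto
  ultimately show ?thesis using pos[of a] by blast
qed

locale inner_form =
  fixes b :: "'a::euclidean_space \<Rightarrow> 'a \<Rightarrow> real"
  assumes bilinear: "bounded_bilinear b"
    and sym: "b u v = b v u"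
    and pos: "v \<noteq> 0 \<Longrightarrow> 0 < b v v"
begin

sublocale bounded_bilinear b by (rule bilinear)

lemma nonneg: "0 \<le> b v v"
  using pos[of v] by (cases "v = 0") (auto simp: zero_left)

text \<open>Excluding real solutions of \<open>A p = -\<omega> q\<close>, \<open>A q = \<omega> p\<close> excludes the eigenvectors
  \<open>p + \<i> q\<close> of \<open>A\<close> for an imaginary eigenvalue \<open>\<i> \<omega>\<close>. A maximiser \<open>a\<close> of \<open>b (A a) (A a)\<close> on
  the unit sphere of \<open>U\<close> satisfies \<open>A (A a) = -\<omega>\<^sup>2 a\<close> and would yield one.\<close>

lemma skew_on_invariant_subspace:
  assumes A: "linear A" and U: "subspace U" and inv: "\<And>u. u \<in> U \<Longrightarrow> A u \<in> U"
    and skew: "\<And>u w. u \<in> U \<Longrightarrow> w \<in> U \<Longrightarrow> b u (A w) = - b w (A u)"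
    and no_imag: "\<And>p q \<omega>. A p = - \<omega> *\<^sub>R q \<Longrightarrow> A q = \<omega> *\<^sub>R p \<Longrightarrow> p = 0"
    and "v \<in> U"
  shows "v = 0"
proof (rule ccontr)
  assume "v \<noteq> 0"
  have bA: "bounded_linear A" using A by (simp add: linear_conv_bounded_linear)
  obtain c where c: "c > 0" "\<And>w. c * (norm w)\<^sup>2 \<le> b w w"
    using pos_quadratic_lower_bound[OF bilinear linear_id] pos by auto
  define S where "S = U \<inter> {w. b w w = 1}"
  have "bounded S"
  proof (rule boundedI)
    fix w assume "w \<in> S"
    hence "(norm w)\<^sup>2 \<le> 1 / c" using c(2)[of w] c(1) by (simp add: S_def field_simps)
    thus "norm w \<le> sqrt (1 / c)" by (rule real_le_rsqrt)
  qed
  moreover have "closed S" unfolding S_def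
    by (intro closed_Int closed_subspace U closed_Collect_eq continuous_intros continuous_on)
  ultimately have "compact S" by (simp add: compact_eq_bounded_closed)
  moreover have "(1 / sqrt (b v v)) *\<^sub>R v \<in> S"
    using U \<open>v \<in> U\<close> pos[OF \<open>v \<noteq> 0\<close>]
    by (simp add: S_def subspace_scale scaleR_left scaleR_right)
  moreover have "continuous_on S (\<lambda>w. b (A w) (A w))"
    by (intro continuous_on linear_continuous_on bA)
  ultimately have "\<exists>a\<in>S. \<forall>w\<in>S. b (A w) (A w) \<le> b (A a) (A a)"
    by (intro continuous_attains_sup) auto
  then obtain a where a: "a \<in> S" "\<And>w. w \<in> S \<Longrightarrow> b (A w) (A w) \<le> b (A a) (A a)" by blast
  define m where "m = b (A a) (A a)"
  have m0: "m \<ge> 0" by (simp add: m_def nonneg)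
  have aU: "a \<in> U" and a1: "b a a = 1" using a(1) by (auto simp: S_def)
  have max: "b (A w) (A w) \<le> m * b w w" if "w \<in> U" for w
  proof (cases "w = 0")
    case True thus ?thesis using A by (simp add: linear_0 zero_left)
  next
    case False
    have "(1 / sqrt (b w w)) *\<^sub>R w \<in> S"
      using U that pos[OF False] by (simp add: S_def subspace_scale scaleR_left scaleR_right)
    from a(2)[OF this] have "b (A w) (A w) / b w w \<le> m"
      using pos[OF False] A by (simp add: m_def linear_scale scaleR_left scaleR_right)
    thus ?thesis using pos[OF False] by (simp add: field_simps)
  qed
  \<comment> \<open>Variation of \<open>max\<close> along \<open>w + t *\<^sub>R a\<close>; the t^2
    terms cancel because \<open>a\<close> attains the maximum.\<close>
  have opt: "m * b a w = b (A a) (A w)" if "w \<in> U" for w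
  proof -
    have "0 \<le> (m * b w w - b (A w) (A w)) + t * (2 * (m * b a w - b (A a) (A w)))" for t
    proof -
      have "w + t *\<^sub>R a \<in> U" using U that aU by (simp add: subspace_add subspace_scale)
      from max[OF this]
      have "b (A w + t *\<^sub>R A a) (A w + t *\<^sub>R A a) \<le> m * b (w + t *\<^sub>R a) (w + t *\<^sub>R a)"
        using A by (simp add: linear_add linear_scale)
      moreover have "b (A w + t *\<^sub>R A a) (A w + t *\<^sub>R A a) = b (A w) (A w) + 2 * t * b (A a) (A w) + t * t * m"
        using sym[of "A w" "A a"] by (simp add: add_left add_right scaleR_left scaleR_right m_def algebra_simps)
      moreover have "b (w + t *\<^sub>R a) (w + t *\<^sub>R a) = b w w + 2 * t * b a w + t * t"
        using sym[of w a] by (simp add: add_left add_right scaleR_left scaleR_right a1 algebra_simps)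
      ultimately show ?thesis by (simp add: algebra_simps)
    qed
    from affine_nonneg_imp_slope_zero[OF this] show ?thesis by simp
  qed
  \<comment> \<open>The residual of the eigenvalue equation. Skewness gives b r (A (A a)) = - b (A
    a) (A r), which \<open>opt\<close> identifies with - m b a r, so \<open>r\<close> is orthogonal
    to itself.\<close>
  define r where "r = m *\<^sub>R a + A (A a)"
  have rU: "r \<in> U" unfolding r_def using U aU inv by (intro subspace_add subspace_scale) auto
  have "b r r = b r (m *\<^sub>R a + A (A a))" unfolding r_def ..
  also have "\<dots> = m * b a r + b r (A (A a))"
    by (simp add: add_right scaleR_right sym[of r a])
  also have "\<dots> = 0" using opt[OF rU] skew[OF rU inv[OF aU]] by simp
  finally have "r = 0" using pos[of r] by fastforce
  hence AA: "A (A a) = - m *\<^sub>R a" by (simp add: r_def eq_neg_iff_add_eq_0 add.commute)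
  have "a = 0"
  proof (cases "m = 0")
    case True
    hence "A a = 0" using pos[of "A a"] by (auto simp: m_def)
    thus ?thesis using no_imag[of a 0 0] A by (simp add: linear_0)
  next
    case False
    have "sqrt m *\<^sub>R a = 0"
      by (rule no_imag[of _ "sqrt m" "- A a"])
        (use AA A m0 in \<open>simp_all add: linear_scale linear_neg\<close>)
    thus ?thesis using False by simp
  qed
  thus False using a1 by (simp add: zero_left)
qed

text \<open>The Lyapunov form is \<open>Y = \<Sum>k<N. (B^k)\<^sup>T b B^k\<close> for the Cayley transform
  \<open>B = (I + A) (I - A)^-1\<close>, which turns the flow of \<open>A\<close> into a nonexpansive map. If no power of
  \<open>B\<close> were strictly contracting, \<open>A\<close> would be skew on a nonzero invariant subspace.\<close>

lemma strict_lyapunov_form: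
  assumes A: "linear A" and diss: "\<And>v. b v (A v) \<le> 0"
    and no_imag: "\<And>p q \<omega>. A p = - \<omega> *\<^sub>R q \<Longrightarrow> A q = \<omega> *\<^sub>R p \<Longrightarrow> p = 0"
  obtains Y where "bounded_bilinear Y" "\<And>u v. Y u v = Y v u"
    "\<And>w. w \<noteq> 0 \<Longrightarrow> (0::real) < Y w w" "\<And>w. w \<noteq> 0 \<Longrightarrow> Y w (A w) < 0"
proof -
  have lin: "linear (\<lambda>w. w - A w)" using A by (intro linear_compose_sub linear_ident)
  have expand_minus: "b (w - A w) (w - A w) = b w w - 2 * b w (A w) + b (A w) (A w)" for w
    by (simp add: diff_left diff_right sym)
  have expand_plus: "b (w + A w) (w + A w) = b w w + 2 * b w (A w) + b (A w) (A w)" for w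
    by (simp add: add_left add_right sym)
  have "inj (\<lambda>w. w - A w)"
    unfolding linear_injective_0[OF lin]
  proof (intro allI impI)
    fix w assume "w - A w = 0"
    hence "b w w \<le> 0" using expand_minus[of w] diss[of w] nonneg[of "A w"] by (simp add: zero_left)
    thus "w = 0" using pos[of w] by fastforce
  qed
  from linear_injective_isomorphism[OF lin this] obtain S where S: "linear S"
    and S1: "\<And>w. S (w - A w) = w" and S2: "\<And>v. S v - A (S v) = v" by blast
  have SA: "S (A v) = A (S v)" for v
  proof -
    have "A v = A (S v) - A (A (S v))" using S2[of v] linear_diff[OF A] by metis
    thus ?thesis using S1 by metis
  qed
  define B where "B = (\<lambda>v. S v + A (S v))"
  have B: "linear B" unfolding B_def
    using A S by (intro linear_compose_add) (auto intro: linear_compose[unfolded o_def])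
  have SB: "S (B v) = B (S v)" for v by (simp add: B_def linear_add[OF S] SA)
  have Bk: "linear (B ^^ k)" for k
    by (induction k) (simp_all only: funpow.simps linear_id linear_compose[OF _ B])
  have bBk: "bounded_linear (B ^^ k)" for k using Bk by (simp add: linear_conv_bounded_linear)
  have SBk: "S ((B ^^ k) v) = (B ^^ k) (S v)" for k v by (induction k) (simp_all add: SB)
  \<comment> \<open>For w = S v one has v = w - A w and B v = w + A w, so the squared norms differ
    by four times the mixed term.\<close>
  have Bb: "b (B v) (B v) = b v v + 4 * b (S v) (A (S v))" for v
    using expand_minus[of "S v"] expand_plus[of "S v"] by (simp add: B_def S2)
  have decr: "b ((B ^^ n) v) ((B ^^ n) v) \<le> b ((B ^^ m) v) ((B ^^ m) v)" if "m \<le> n" for m n v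
    using that
  proof (induction n rule: dec_induct)
    case (step n) thus ?case using Bb[of "(B ^^ n) v"] diss[of "S ((B ^^ n) v)"] by simp
  qed simp

  have "\<exists>N. \<forall>v. v \<noteq> 0 \<longrightarrow> b ((B ^^ N) v) ((B ^^ N) v) < b v v"
  proof (rule ccontr)
    assume "\<not> ?thesis"
    hence no: "\<exists>v. v \<noteq> 0 \<and> b v v \<le> b ((B ^^ N) v) ((B ^^ N) v)" for N by (meson not_less)
    \<comment> \<open>Unit vectors that the N-th power fails to contract. By \<open>decr\<close>
      these compact sets are nested, and a common element has its b-norm preserved by every
      power.\<close>
    define F where "F = (\<lambda>N. sphere 0 1 \<inter> {v. b v v \<le> b ((B ^^ N) v) ((B ^^ N) v)})"
    have "\<Inter>(range F) \<noteq> {}"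
    proof (rule compact_nest)
      fix N
      show "compact (F N)" unfolding F_def
        by (intro compact_Int_closed compact_sphere closed_Collect_le continuous_on continuous_intros
            linear_continuous_on bBk)
      obtain v where v: "v \<noteq> 0" "b v v \<le> b ((B ^^ N) v) ((B ^^ N) v)" using no by blast
      have "v /\<^sub>R norm v \<in> F N"
        using v by (simp add: F_def linear_scale[OF Bk] scaleR_left scaleR_right mult_left_mono)
      thus "F N \<noteq> {}" by blast
    next
      fix m n :: nat assume "m \<le> n"
      thus "F n \<subseteq> F m" unfolding F_def using decr order_trans by blast
    qed
    then obtain v where "\<And>N. v \<in> F N" by blast
    hence v: "norm v = 1" "\<And>N. b v v \<le> b ((B ^^ N) v) ((B ^^ N) v)" by (auto simp: F_def)
    have iso: "b ((B ^^ k) v) ((B ^^ k) v) = b v v" for k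
      using v(2)[of k] decr[of 0 k v] by simp
    \<comment> \<open>The kernel of the b-symmetric part of \<open>A\<close>. As that part is
      semidefinite, the single equation b w (A w) = 0 already puts \<open>w\<close> there, which is
      \<open>null\<close>.\<close>
    define Z where "Z = {w. \<forall>u. b w (A u) + b u (A w) = 0}"
    have Z: "subspace Z" unfolding Z_def
    proof (intro subspaceI)
      fix x y assume xy: "x \<in> {w. \<forall>u. b w (A u) + b u (A w) = 0}" "y \<in> {w. \<forall>u. b w (A u) + b u (A w) = 0}"
      have "b (x + y) (A u) + b u (A (x + y)) = (b x (A u) + b u (A x)) + (b y (A u) + b u (A y))" for u
        by (simp add: linear_add[OF A] add_left add_right)
      thus "x + y \<in> {w. \<forall>u. b w (A u) + b u (A w) = 0}" using xy by simp
    next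
      fix x and c :: real assume x: "x \<in> {w. \<forall>u. b w (A u) + b u (A w) = 0}"
      have "b (c *\<^sub>R x) (A u) + b u (A (c *\<^sub>R x)) = c * (b x (A u) + b u (A x))" for u
        by (simp add: linear_scale[OF A] scaleR_left scaleR_right algebra_simps)
      thus "c *\<^sub>R x \<in> {w. \<forall>u. b w (A u) + b u (A w) = 0}" using x by simp
    qed (simp add: zero_left zero_right linear_0[OF A])
    have null: "w \<in> Z" if w: "b w (A w) = 0" for w
    proof -
      have "b w (A u) + b u (A w) = 0" for u
      proof -
        have "0 \<le> - b u (A u) + t * (- (b w (A u) + b u (A w)))" for t
          using diss[of "u + t *\<^sub>R w"] w
          by (simp add: linear_add[OF A] linear_scale[OF A] add_left add_right scaleR_left scaleR_right algebra_simps)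
        from affine_nonneg_imp_slope_zero[OF this] show ?thesis by simp
      qed
      thus ?thesis by (simp add: Z_def)
    qed
    \<comment> \<open>The largest B-invariant subspace of \<open>Z\<close>: on it \<open>A\<close>
      is skew at every iterate.\<close>
    define U where "U = {u. \<forall>k. (B ^^ k) u \<in> Z}"
    have U: "subspace U" unfolding U_def
      using Z by (intro subspaceI) (auto simp: linear_0[OF Bk] linear_add[OF Bk] linear_scale[OF Bk]
          subspace_0 subspace_add subspace_scale)
    have UB: "B u \<in> U" if "u \<in> U" for u
    proof -
      have "(B ^^ Suc k) u \<in> Z" for k using that unfolding U_def by blast
      thus ?thesis by (simp add: U_def funpow_swap1)
    qed
    have US: "2 *\<^sub>R S u \<in> U" if "u \<in> U" for u
    proof -
      have "u + B u = 2 *\<^sub>R S u" using S2[of u] by (simp add: B_def scaleR_2 algebra_simps)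
      thus ?thesis using U UB[OF that] that subspace_add by metis
    qed
    have lin2: "linear (\<lambda>u. 2 *\<^sub>R S u)" using S by (rule linear_compose_scale_right)
    have inj2: "inj (\<lambda>u. 2 *\<^sub>R S u)"
    proof (rule injI)
      fix u w assume "2 *\<^sub>R S u = 2 *\<^sub>R S w"
      hence "S u = S w" by simp
      thus "u = w" using S2 by metis
    qed
    \<comment> \<open>As I + B = 2 S, the map 2 S sends \<open>U\<close> into itself, and
      injectivity in finite dimension makes it onto. Writing u = 2 S w turns A u into B w - w,
      whence \<open>U\<close> is A-invariant too.\<close>
    have onto: "(\<lambda>u. 2 *\<^sub>R S u) ` U = U"
    proof (rule subspace_dim_equal)
      show "subspace ((\<lambda>u. 2 *\<^sub>R S u) ` U)" by (rule linear_subspace_image[OF lin2 U])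
      show "dim U \<le> dim ((\<lambda>u. 2 *\<^sub>R S u) ` U)"
        using dim_image_eq[OF lin2, of U] inj2 by (simp add: inj_on_subset)
    qed (use U US in auto)
    have UA: "A u \<in> U" if "u \<in> U" for u
    proof -
      have "u \<in> (\<lambda>u. 2 *\<^sub>R S u) ` U" using that by (simp only: onto)
      then obtain w where w: "u = 2 *\<^sub>R S w" "w \<in> U" by (rule imageE)
      have "B w - (S w - A (S w)) = A u"
        by (simp add: B_def w(1) linear_add[OF A] scaleR_2)
      hence "B w - w = A u" by (simp only: S2)
      thus ?thesis using subspace_diff[OF U UB[OF w(2)] w(2)] by simp
    qed
    \<comment> \<open>Equal b-norms of consecutive iterates force the dissipation in
      \<open>Bb\<close> to vanish at \<open>S\<close> of each iterate.\<close>
    have SvU: "S v \<in> U"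
    proof -
      have "(B ^^ k) (S v) \<in> Z" for k
        using Bb[of "(B ^^ k) v"] iso[of k] iso[of "Suc k"] by (intro null) (simp add: SBk)
      thus ?thesis by (simp add: U_def)
    qed
    have skew: "b u (A w) = - b w (A u)" if "u \<in> U" for u w
    proof -
      have "(B ^^ 0) u \<in> Z" using that unfolding U_def by blast
      thus ?thesis by (simp add: Z_def eq_neg_iff_add_eq_0)
    qed
    have "S v = 0"
      by (rule skew_on_invariant_subspace[OF A U UA skew no_imag SvU])
    hence "v = 0" using S2[of v] linear_0[OF A] by simp
    thus False using v(1) by simp
  qed
  then obtain N where N: "\<And>v. v \<noteq> 0 \<Longrightarrow> b ((B ^^ N) v) ((B ^^ N) v) < b v v" by blast
  define Y where "Y = (\<lambda>u v. \<Sum>k<N. b ((B ^^ k) u) ((B ^^ k) v))"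
  have Y: "bounded_bilinear Y" unfolding Y_def
    unfolding bilinear_conv_bounded_bilinear[symmetric] bilinear_def
    by (auto intro!: linearI simp: linear_add[OF Bk] linear_scale[OF Bk] add_left add_right
        scaleR_left scaleR_right sum.distrib sum_distrib_left)
  interpret Y: bounded_bilinear Y by (rule Y)
  have Ysym: "Y u v = Y v u" for u v unfolding Y_def by (intro sum.cong refl sym)
  have Y_strict: "0 < Y w w" "Y w (A w) < 0" if w: "w \<noteq> 0" for w
  proof -
    have "N \<noteq> 0" using N[OF w] by (cases N) auto
    have "0 < b ((B ^^ 0) w) ((B ^^ 0) w)" using pos[OF w] by simp
    also have "\<dots> \<le> Y w w" unfolding Y_def using \<open>N \<noteq> 0\<close>
      by (intro member_le_sum nonneg) auto
    finally show "0 < Y w w" .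
    \<comment> \<open>The change of \<open>Y\<close> from v to B v equals 4 Y w (A w) by expansion
      and, by telescoping, the strictly negative change of b over \<open>N\<close> steps.\<close>
    define v where "v = w - A w"
    have Sv: "S v = w" by (simp add: v_def S1)
    have v0: "v \<noteq> 0" using Sv w linear_0[OF S] by auto
    have "Y (B v) (B v) - Y v v = (\<Sum>k<N. b ((B ^^ Suc k) v) ((B ^^ Suc k) v) - b ((B ^^ k) v) ((B ^^ k) v))"
      by (simp add: Y_def sum_subtractf funpow_swap1)
    also have "\<dots> = b ((B ^^ N) v) ((B ^^ N) v) - b v v" by (subst sum_lessThan_telescope) simp
    finally have "Y (B v) (B v) < Y v v" using N[OF v0] by simp
    moreover have "Y (B v) (B v) = Y w w + 2 * Y w (A w) + Y (A w) (A w)"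
      by (simp add: B_def Sv Y.add_left Y.add_right Ysym[of "A w" w])
    moreover have "Y v v = Y w w - 2 * Y w (A w) + Y (A w) (A w)"
      by (simp add: v_def Y.diff_left Y.diff_right Ysym[of "A w" w])
    ultimately show "Y w (A w) < 0" by simp
  qed
  show thesis by (rule that[OF Y Ysym Y_strict])
qed

end

section \<open>Strictly stable equilibria\<close>

text \<open>The two equations are the real and imaginary parts of A (p + i q) = i \<omega> (p + i
  q).\<close>

lemma imaginary_eigenvalue_of_real_pair:
  fixes A :: "real^'n^'n"
  assumes "A *v p = - \<omega> *\<^sub>R q" "A *v q = \<omega> *\<^sub>R p" "p \<noteq> 0"
  shows "complex_eigenvalue A (\<i> * \<omega>)"
proof -
  define v :: "complex^'n" where "v = (\<chi> i. Complex (p $ i) (q $ i))"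
  obtain i where "p $ i \<noteq> 0" using assms(3) by (auto simp: vec_eq_iff)
  hence "v $ i \<noteq> 0" by (simp add: v_def complex_eq_iff)
  hence "v \<noteq> 0" by auto
  moreover have "map_matrix complex_of_real A *v v = (\<i> * \<omega>) *s v"
  proof (subst vec_eq_iff, intro allI)
    fix i
    have "(\<Sum>j\<in>UNIV. A $ i $ j * p $ j) = - \<omega> * q $ i" "(\<Sum>j\<in>UNIV. A $ i $ j * q $ j) = \<omega> * p $ i"
      using assms(1,2) by (simp_all add: vec_eq_iff matrix_vector_mult_def)
    moreover have "(\<Sum>j\<in>UNIV. complex_of_real (A $ i $ j) * Complex (p $ j) (q $ j))
        = Complex (\<Sum>j\<in>UNIV. A $ i $ j * p $ j) (\<Sum>j\<in>UNIV. A $ i $ j * q $ j)"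
      by (simp add: complex_eq_iff)
    ultimately show "(map_matrix complex_of_real A *v v) $ i = ((\<i> * \<omega>) *s v) $ i"
      by (simp add: matrix_vector_mult_def v_def complex_eq_iff)
  qed
  ultimately show ?thesis unfolding complex_eigenvalue_def by blast
qed

lemma jacobian_mult_eq:
  fixes f :: "real^'m \<Rightarrow> real^'n"
  assumes "(f has_derivative D) (at x)"
  shows "jacobian f (at x) *v v = D v"
proof -
  have "(f has_derivative (\<lambda>v. jacobian f (at x) *v v)) (at x)"
    by (rule jacobian_works[THEN iffD1, OF differentiableI[OF assms]])
  thus ?thesis using has_derivative_unique[OF _ assms] by metis
qed

lemma sum_partial_deriv_eq:
  fixes f :: "real^'n \<Rightarrow> 'b::real_normed_vector"
  assumes "(f has_derivative D) (at x)"
  shows "(\<Sum>i\<in>UNIV. (v $ i) *\<^sub>R partial_deriv f i x) = D v"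
proof -
  interpret D: linear D using assms by (rule has_derivative_linear)
  have "(\<Sum>i\<in>UNIV. (v $ i) *\<^sub>R partial_deriv f i x) = (\<Sum>i\<in>UNIV. (v $ i) *\<^sub>R D (axis i 1))"
    unfolding partial_deriv_def frechet_derivative_at[OF assms, symmetric] ..
  also have "\<dots> = D (\<Sum>i\<in>UNIV. (v $ i) *\<^sub>R axis i 1)" by (simp add: D.sum D.scale)
  also have "(\<Sum>i\<in>UNIV. (v $ i) *\<^sub>R axis i 1) = v"
    using basis_expansion[of v] by (simp add: scalar_mult_eq_scaleR)
  finally show ?thesis .
qed

context semi_contracting_equilibrium
begin

lemma strictly_stable_imp_locally_attractive:
  assumes "strictly_stable_linearization h xs"
  shows "locally_attractive h xs"
proof -
  define A where "A = blinfun_apply (Dh xs)"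
  have A: "linear A" unfolding A_def by (simp add: blinfun.bounded_linear_right bounded_linear.linear)
  define b where "b = (\<lambda>u v. u \<bullet> (M xs *v v))"
  have "bounded_bilinear b" unfolding b_def
    unfolding bilinear_conv_bounded_bilinear[symmetric] bilinear_def
    by (auto intro!: linearI simp: algebra_simps inner_add_left inner_add_right matrix_vector_mult_scaleR)
  moreover have "0 < b v v" if "v \<noteq> 0" for v
  proof -
    have "0 < b\<^sub>0 * (norm v)\<^sup>2" using b0_pos that by simp
    thus ?thesis using M_lower[of v xs] by (simp add: b_def)
  qed
  moreover have "b u v = b v u" for u v unfolding b_def by (rule M_sym)
  ultimately interpret inner_form b by (intro inner_form.intro)
  \<comment> \<open>At an equilibrium the metric derivative drops out, being linear in
    \<open>h xs\<close>.\<close>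
  have diss: "b v (A v) \<le> 0" for v
    using contraction[of v xs] equilibrium by (simp add: b_def A_def blinfun.zero_right)
  have no_imag: "p = 0" if "A p = - \<omega> *\<^sub>R q" "A q = \<omega> *\<^sub>R p" for p q \<omega>
  proof (rule ccontr)
    assume "p \<noteq> 0"
    hence "complex_eigenvalue (jacobian h (at xs)) (\<i> * \<omega>)"
      using that by (intro imaginary_eigenvalue_of_real_pair) (simp_all add: jacobian_mult_eq[OF h_deriv] A_def)
    thus False using assms unfolding strictly_stable_linearization_def by fastforce
  qed
  obtain Y where Y: "bounded_bilinear Y" and Ysym: "\<And>u v. Y u v = Y v u"
    and Ypos: "\<And>w. w \<noteq> 0 \<Longrightarrow> (0::real) < Y w w" and YA: "\<And>w. w \<noteq> 0 \<Longrightarrow> Y w (A w) < 0"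
    by (rule strict_lyapunov_form[OF A diss]) (erule (1) no_imag, rule that, assumption, blast+)
  interpret Y: bounded_bilinear Y by (rule Y)
  obtain c where c: "c > 0" "\<And>w. c * (norm w)\<^sup>2 \<le> Y w w"
    using pos_quadratic_lower_bound[OF Y linear_id] Ypos by auto
  have "\<exists>m>0. \<forall>w. m * (norm w)\<^sup>2 \<le> Y w (- A w)"
    by (rule pos_quadratic_lower_bound[OF Y]) (use A YA in \<open>auto simp: linear_compose_neg Y.minus_right\<close>)
  then obtain m where "m > 0" and m': "\<And>w. m * (norm w)\<^sup>2 \<le> Y w (- A w)" by blast
  hence m: "m > 0" "Y w (A w) \<le> - m * (norm w)\<^sup>2" for w
    using m'[of w] unfolding Y.minus_right by linarith+
  obtain K where K: "K > 0" "\<And>u v. norm (Y u v) \<le> norm u * norm v * K" using Y.pos_bounded by blast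
  \<comment> \<open>With this tolerance the nonlinear remainder consumes at most half of the linear
    decay rate \<open>m\<close>.\<close>
  have \<epsilon>: "m / (2 * K) > 0" using m K by simp
  obtain \<delta> where \<delta>: "\<delta> > 0" and lin: "\<And>y. norm (y - xs) < \<delta> \<Longrightarrow>
      norm (h y - A (y - xs)) \<le> m / (2 * K) * norm (y - xs)"
  proof -
    obtain \<delta> where "\<delta> > 0" "\<forall>y. norm (y - xs) < \<delta> \<longrightarrow>
        norm (h y - h xs - Dh xs (y - xs)) \<le> m / (2 * K) * norm (y - xs)"
      using h_deriv[of xs] \<epsilon> unfolding has_derivative_at_alt by blast
    thus thesis using that by (simp add: equilibrium A_def)
  qed
  \<comment> \<open>Starting within \<open>\<delta> / gain\<close>, a trajectory stays within
    \<delta> forever by \<open>trajectory_bounded\<close>, so no invariant sublevel set of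
    \<open>Y\<close> has to be found.\<close>
  have "(x \<longlongrightarrow> xs) at_top" if x: "trajectory h x" and x0: "x 0 \<in> ball xs (\<delta> / gain)" for x
  proof -
    define e where "e = (\<lambda>t. x t - xs)"
    define F where "F = (\<lambda>t. Y (e t) (e t))"
    have ec: "continuous_on {0..} e" unfolding e_def by (intro continuous_intros continuous_on_trajectory[OF x])
    have Fc: "continuous_on {0..} F" unfolding F_def by (intro Y.continuous_on ec)
    have near: "norm (e t) < \<delta>" if "t \<ge> 0" for t
    proof -
      have "norm (e t) \<le> gain * norm (x 0 - xs)"
        using trajectory_bounded[OF x that] by (simp add: e_def)
      also have "\<dots> < \<delta>" using x0 gain_pos by (simp add: dist_norm norm_minus_commute field_simps)
      finally show ?thesis .
    qed
    \<comment> \<open>The derivative of F is at most - m |e|^2, and F is at most K |e|^2, which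
      gives the rate \<open>m / K\<close>.\<close>
    have decay: "exp (m / K * t) * F t \<le> F 0" if t: "t \<ge> 0" for t
    proof -
      have "exp (m / K * t) * F t \<le> exp (m / K * 0) * F 0"
      proof (rule DERIV_nonpos_imp_decreasing_open[where f = "\<lambda>t. exp (m / K * t) * F t"])
        show "continuous_on {0..t} (\<lambda>t. exp (m / K * t) * F t)"
          by (intro continuous_intros continuous_on_subset[OF Fc]) auto
        fix s assume s: "0 < s" "s < t"
        have ed: "(e has_vector_derivative h (x s)) (at s)"
          unfolding e_def using trajectory_at_interior[OF x s(1)] by (auto intro!: derivative_eq_intros)
        have "(F has_vector_derivative (Y (e s) (h (x s)) + Y (h (x s)) (e s))) (at s)"
          unfolding F_def by (rule Y.has_vector_derivative[OF ed ed])
        hence Fd: "(F has_real_derivative 2 * Y (e s) (h (x s))) (at s)"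
          by (simp add: has_real_derivative_iff_has_vector_derivative Ysym[of "h (x s)" "e s"])
        define \<rho> where "\<rho> = h (x s) - A (e s)"
        have "norm \<rho> \<le> m / (2 * K) * norm (e s)" using lin[of "x s"] near[of s] s by (simp add: \<rho>_def e_def)
        hence "norm (e s) * norm \<rho> * K \<le> norm (e s) * (m / (2 * K) * norm (e s)) * K"
          using K by (intro mult_right_mono mult_left_mono) auto
        also have "\<dots> = m / 2 * (norm (e s))\<^sup>2" using K by (simp add: power2_eq_square field_simps)
        finally have "Y (e s) \<rho> \<le> m / 2 * (norm (e s))\<^sup>2" using K(2)[of "e s" \<rho>] by simp
        moreover have "Y (e s) (h (x s)) = Y (e s) (A (e s)) + Y (e s) \<rho>"
          by (simp add: \<rho>_def Y.diff_right)
        ultimately have "2 * Y (e s) (h (x s)) \<le> - m * (norm (e s))\<^sup>2" using m(2)[of "e s"] by simp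
        moreover have "m / K * F s \<le> m * (norm (e s))\<^sup>2"
        proof -
          have "F s \<le> K * (norm (e s))\<^sup>2"
            using K(2)[of "e s" "e s"] by (simp add: F_def power2_eq_square mult_ac)
          hence "m / K * F s \<le> m / K * (K * (norm (e s))\<^sup>2)" using m K by (intro mult_left_mono) auto
          also have "\<dots> = m * (norm (e s))\<^sup>2" using K(1) by simp
          finally show ?thesis .
        qed
        ultimately have "2 * Y (e s) (h (x s)) + m / K * F s \<le> 0" by simp
        moreover have "((\<lambda>t. exp (m / K * t) * F t) has_real_derivative
            exp (m / K * s) * (2 * Y (e s) (h (x s)) + m / K * F s)) (at s)"
          using K(1) by (auto intro!: derivative_eq_intros Fd simp: algebra_simps)
        ultimately show "\<exists>d. ((\<lambda>t. exp (m / K * t) * F t) has_real_derivative d) (at s) \<and> d \<le> 0"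
          by (meson exp_ge_zero mult_nonneg_nonpos)
      qed (use t in auto)
      thus ?thesis by simp
    qed
    have bound: "(norm (e t))\<^sup>2 \<le> F 0 / c * exp (- (m / K * t))" if t: "t \<ge> 0" for t
    proof -
      have "exp (- (m / K * t)) * (exp (m / K * t) * F t) \<le> exp (- (m / K * t)) * F 0"
        by (intro mult_left_mono decay t) auto
      hence "F t \<le> exp (- (m / K * t)) * F 0" by (simp add: mult.assoc[symmetric] flip: exp_add)
      hence "c * (norm (e t))\<^sup>2 \<le> exp (- (m / K * t)) * F 0" using c(2)[of "e t"] by (simp add: F_def)
      thus ?thesis using c(1) by (simp add: field_simps)
    qed
    have "filterlim (\<lambda>t. m / K * t) at_top at_top"
      by (rule filterlim_tendsto_pos_mult_at_top[OF tendsto_const _ filterlim_ident]) (use m K in auto)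
    hence "((\<lambda>t. exp (- (m / K * t))) \<longlongrightarrow> 0) at_top"
      by (intro filterlim_compose[OF exp_at_bot]) (simp add: filterlim_uminus_at_top)
    hence lim: "((\<lambda>t. F 0 / c * exp (- (m / K * t))) \<longlongrightarrow> 0) at_top"
      by (rule tendsto_mult_right_zero)
    have "\<forall>\<^sub>F t in at_top. (norm (e t))\<^sup>2 \<le> F 0 / c * exp (- (m / K * t))"
      using eventually_ge_at_top[of 0] by (rule eventually_mono) (rule bound)
    hence "((\<lambda>t. (norm (e t))\<^sup>2) \<longlongrightarrow> 0) at_top"
      by (intro tendsto_sandwich[OF _ _ tendsto_const lim]) auto
    hence "((\<lambda>t. sqrt ((norm (e t))\<^sup>2)) \<longlongrightarrow> sqrt 0) at_top" by (rule tendsto_real_sqrt)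
    hence "(e \<longlongrightarrow> 0) at_top" by (simp add: tendsto_norm_zero_iff)
    thus ?thesis unfolding e_def by (simp add: LIM_zero_iff)
  qed
  thus ?thesis unfolding locally_attractive_def using \<delta> gain_pos
    by (intro exI[of _ "\<delta> / gain"]) auto
qed

end

section \<open>Monotone cost along trajectories and the final statement\<close>

lemma lyapunov_function_nonincreasing:
  fixes V :: "real^'n \<Rightarrow> real"
  assumes V: "\<And>x. (V has_derivative V' x) (at x)" and neg: "\<And>x. V' x (h x) \<le> 0"
    and x: "trajectory h x" and t: "t \<ge> 0"
  shows "V (x t) \<le> V (x 0)"
proof (rule DERIV_nonpos_imp_decreasing_open[where f = "\<lambda>t. V (x t)"])
  have "continuous_on UNIV V"
    by (intro continuous_at_imp_continuous_on ballI has_derivative_continuous[OF V])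
  thus "continuous_on {0..t} (\<lambda>t. V (x t))"
    by (rule continuous_on_compose2) (auto intro: continuous_on_subset[OF continuous_on_trajectory[OF x]])
  fix s assume "0 < s" "s < t"
  hence "(x has_vector_derivative h (x s)) (at s)" using x trajectory_at_interior by blast
  from vector_derivative_diff_chain_within[OF this, of V "V' (x s)"]
  have "((\<lambda>t. V (x t)) has_real_derivative V' (x s) (h (x s))) (at s)"
    by (simp add: V has_derivative_at_withinI o_def has_real_derivative_iff_has_vector_derivative)
  thus "\<exists>d. ((\<lambda>t. V (x t)) has_real_derivative d) (at s) \<and> d \<le> 0" using neg by blast
qed (rule t)

lemma inner_transpose_matrix: "u \<bullet> (transpose A *v v) = v \<bullet> (A *v (u::real^'n))"
  using dot_lmul_matrix[of v A u] by (simp add: inner_commute)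

theorem proposition9:
  fixes h :: "real^'n \<Rightarrow> real^'n"
    and M :: "real^'n \<Rightarrow> real^'n^'n"
    and V :: "real^'n \<Rightarrow> real"
    and xs :: "real^'n"
  assumes "continuously_differentiable h"
    and "continuously_differentiable M"
    and "continuously_differentiable V"
    and "bounded_metric M"
    and "semi_contracting h M"
    and "\<forall>x. orbital_deriv h V x \<le> 0"
    and "equilibrium h xs"
    and "locally_attractive h xs \<or> strictly_stable_linearization h xs"
  shows "(\<forall>y. equilibrium h y \<longrightarrow> y = xs)
       \<and> (\<forall>y. V xs \<le> V y)
       \<and> (\<forall>y. \<exists>x. trajectory h x \<and> x 0 = y)
       \<and> (\<forall>x. trajectory h x \<longrightarrow> (x \<longlongrightarrow> xs) at_top)"
proof -
  have minus_mult: "(- A) *v v = - (A *v v)" for A :: "real^'n^'n" and v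
    by (metis diff_0 matrix_vector_mult_diff_rdistrib matrix_vector_mult_0)
  obtain Dh where Dh: "\<And>x. (h has_derivative blinfun_apply (Dh x)) (at x)" "continuous_on UNIV Dh"
    using assms(1) unfolding continuously_differentiable_def by blast
  obtain DM where DM: "\<And>x. (M has_derivative blinfun_apply (DM x)) (at x)"
    using assms(2) unfolding continuously_differentiable_def by blast
  obtain DV where DV: "\<And>x. (V has_derivative blinfun_apply (DV x)) (at x)"
    using assms(3) unfolding continuously_differentiable_def by blast
  obtain \<beta>\<^sub>0 \<beta>\<^sub>1 :: real where \<beta>: "\<And>x. 0 \<prec>\<^sub>L \<beta>\<^sub>0\<^sup>2 *\<^sub>R (mat 1 :: real^'n^'n)"
      "\<And>x. \<beta>\<^sub>0\<^sup>2 *\<^sub>R mat 1 \<preceq>\<^sub>L M x" "\<And>x. M x \<preceq>\<^sub>L \<beta>\<^sub>1\<^sup>2 *\<^sub>R mat 1"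
    using assms(4) unfolding bounded_metric_def by blast
  have id: "v \<bullet> ((c *\<^sub>R mat 1) *v v) = c * (norm v)\<^sup>2" for c and v :: "real^'n"
    by (simp add: power2_norm_eq_inner flip: scaleR_matrix_vector_assoc)
  \<comment> \<open>Adding 1 to the upper constant makes its positivity immediate, without comparing
    the two bounds.\<close>
  interpret semi_contracting_equilibrium h M Dh DM "\<beta>\<^sub>0\<^sup>2" "\<beta>\<^sub>1\<^sup>2 + 1" xs
  proof
    show "u \<bullet> (M x *v v) = v \<bullet> (M x *v u)" for x u v
      using assms(4) inner_transpose_matrix[of u "M x" v]
      unfolding bounded_metric_def matrix_metric_def pos_definite_def by simp
    show "0 < \<beta>\<^sub>0\<^sup>2"
      using \<beta>(1) unfolding loewner_less_def pos_definite_def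
      by (metis id diff_zero axis_eq_0_iff zero_neq_one norm_axis_1 mult.right_neutral one_power2)
    show "\<beta>\<^sub>0\<^sup>2 * (norm v)\<^sup>2 \<le> v \<bullet> (M x *v v)" for x v
    proof -
      have "0 \<le> v \<bullet> ((M x - \<beta>\<^sub>0\<^sup>2 *\<^sub>R mat 1) *v v)"
        using \<beta>(2) unfolding loewner_le_def pos_semidefinite_def by blast
      thus ?thesis by (simp add: matrix_vector_mult_diff_rdistrib inner_diff_right id)
    qed
    show "v \<bullet> (M x *v v) \<le> (\<beta>\<^sub>1\<^sup>2 + 1) * (norm v)\<^sup>2" for x v
    proof -
      have "0 \<le> v \<bullet> ((\<beta>\<^sub>1\<^sup>2 *\<^sub>R mat 1 - M x) *v v)"
        using \<beta>(3) unfolding loewner_le_def pos_semidefinite_def by blast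
      hence "v \<bullet> (M x *v v) \<le> \<beta>\<^sub>1\<^sup>2 * (norm v)\<^sup>2"
        by (simp add: matrix_vector_mult_diff_rdistrib inner_diff_right id)
      thus ?thesis by (simp add: algebra_simps add_increasing)
    qed
    show "v \<bullet> (DM x (h x) *v v) + 2 * (v \<bullet> (M x *v Dh x v)) \<le> 0" for x v
    proof -
      let ?A = "jacobian h (at x)"
      have "0 \<le> v \<bullet> ((0 - (metric_deriv h M x + transpose ?A ** M x + M x ** ?A)) *v v)"
        using assms(5) unfolding semi_contracting_def Let_def loewner_le_def pos_semidefinite_def by blast
      hence "v \<bullet> (metric_deriv h M x *v v) + v \<bullet> (transpose ?A *v (M x *v v)) + v \<bullet> (M x *v (?A *v v)) \<le> 0"
        by (simp only: diff_0 minus_mult matrix_vector_mult_add_rdistrib inner_minus_right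
            inner_add_right matrix_vector_mul_assoc[symmetric] neg_0_le_iff_le)
      moreover have "metric_deriv h M x = DM x (h x)"
        unfolding metric_deriv_def by (rule sum_partial_deriv_eq[OF DM])
      moreover have "v \<bullet> (transpose ?A *v (M x *v v)) = v \<bullet> (M x *v (?A *v v))"
        using \<open>\<And>x u v. u \<bullet> (M x *v v) = v \<bullet> (M x *v u)\<close>[of "?A *v v" x v]
        by (simp only: inner_transpose_matrix inner_commute)
      ultimately show ?thesis by (simp add: jacobian_mult_eq[OF Dh(1)])
    qed
  qed (use Dh DM assms(7) in \<open>auto simp: equilibrium_def add_nonneg_pos\<close>)
  have conv: "(x \<longlongrightarrow> xs) at_top" if "trajectory h x" for x
    using assms(8) strictly_stable_imp_locally_attractive globally_attractive that by blast
  have "y = xs" if "equilibrium h y" for y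
  proof -
    have "((\<lambda>t::real. y) \<longlongrightarrow> xs) at_top"
      using that by (intro conv trajectory_const) (simp add: equilibrium_def)
    thus ?thesis by (simp add: tendsto_const_iff)
  qed
  moreover have "V xs \<le> V y" for y
  proof -
    obtain x where x: "trajectory h x" "x 0 = y" using trajectory_exists by blast
    have neg: "DV z (h z) \<le> 0" for z
      using assms(6)[rule_format, of z] sum_partial_deriv_eq[OF DV, of "h z" z]
      by (simp add: orbital_deriv_def gradient_def inner_vec_def mult.commute)
    \<comment> \<open>The cost never exceeds \<open>V y\<close> along the trajectory from
      \<open>y\<close>, and continuity passes this to the limit \<open>xs\<close>.\<close>
    have lim: "((\<lambda>t. V (x t)) \<longlongrightarrow> V xs) at_top"
      by (rule isCont_tendsto_compose[OF has_derivative_continuous[OF DV] conv[OF x(1)]])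
    have "\<forall>\<^sub>F t in at_top. V (x t) \<le> V y"
      using eventually_ge_at_top[of 0]
      by (rule eventually_mono) (use lyapunov_function_nonincreasing[OF DV neg x(1)] x(2) in blast)
    thus ?thesis by (rule tendsto_upperbound[OF lim _ trivial_limit_at_top_linorder])
  qed
  ultimately show ?thesis by (intro conjI allI impI trajectory_exists conv)
qed

end
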